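(* Let $p\neq 2$ be a prime number, let $l\geq 1$ be an integer, and let $n$ be a natural number with $\gcd(n,p)=1$. Then the monomial dynamical system $x\mapsto x^n$ is minimal on the sphere $S_{p^{-l}}(1)$ if and only if $n$ is a generator of $G_{p^2}$.
   Context: $\mathbb{Q}_p$ is the field of $p$-adic numbers with $p$-adic absolute value $|\cdot|_p$ normalized by $|p|_p=p^{-1}$. For $a\in\mathbb{Q}_p$ and $r=p^k$, $k\in\mathbb{Z}$, the sphere is $S_r(a)=\{x\in\mathbb{Q}_p: |x-a|_p=r\}$. $G_{p^2}$ denotes the multiplicative group of units of the residue ring $\mathbb{Z}/p^2\mathbb{Z}$; "$n$ is a generator of $G_{p^2}$" means that the residue class of $n$ modulo $p^2$ generates this group. When $\gcd(n,p)=1$, the map $x\mapsto x^n$ maps $S_{p^{-l}}(1)$ into itself. A continuous map $\psi$ of a compact metric space $X$ into itself is called (one-sided) minimal if for every $x\in X$ the orbit $\{\psi^N(x): N\in\mathbb{N}\}$ is dense in $X$, where $\psi^N$ is the $N$-fold iterate. *)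

theory Defs
  imports
    "HOL-Analysis.Analysis"
    "HOL-Number_Theory.Residues"
    "HOL-Algebra.QuotRing"
    "HOL-Algebra.Generated_Groups"
begin

definition rat_padic_abs :: "nat \<Rightarrow> rat \<Rightarrow> real" where
  "rat_padic_abs p x =
     (if x = 0 then 0
      else real p powi (int (multiplicity (int p) (snd (quotient_of x)))
                        - int (multiplicity (int p) (fst (quotient_of x)))))"

text \<open>
  The field of \<open>p\<close>-adic numbers is built as the completion of the rationals with respect to
  \<open>rat_padic_abs p\<close>: the ring of Cauchy sequences modulo the ideal of null sequences.
  Its elements are therefore cosets, i.e. sets of rational sequences.
\<close>

definition padic_Cauchy :: "nat \<Rightarrow> (nat \<Rightarrow> rat) \<Rightarrow> bool" where
  "padic_Cauchy p f \<longleftrightarrow>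
     (\<forall>e>0. \<exists>M. \<forall>i\<ge>M. \<forall>j\<ge>M. rat_padic_abs p (f i - f j) < e)"

definition padic_Cauchy_ring :: "nat \<Rightarrow> (nat \<Rightarrow> rat) ring" where
  "padic_Cauchy_ring p =
     \<lparr>carrier = {f. padic_Cauchy p f},
      mult = (\<lambda>f g i. f i * g i), one = (\<lambda>i. 1),
      zero = (\<lambda>i. 0), add = (\<lambda>f g i. f i + g i)\<rparr>"

definition padic_null :: "nat \<Rightarrow> (nat \<Rightarrow> rat) set" where
  "padic_null p = {f. (\<lambda>i. rat_padic_abs p (f i)) \<longlonglongrightarrow> 0}"

definition padic_field :: "nat \<Rightarrow> (nat \<Rightarrow> rat) set ring" where
  "padic_field p = padic_Cauchy_ring p Quot padic_null p"

text \<open>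
  The absolute values of the terms of a Cauchy sequence converge, and the limit depends only on
  the coset, so the following description determines a unique real number.
\<close>

definition padic_abs :: "nat \<Rightarrow> (nat \<Rightarrow> rat) set \<Rightarrow> real" where
  "padic_abs p x = (THE c. \<forall>f\<in>x. (\<lambda>i. rat_padic_abs p (f i)) \<longlonglongrightarrow> c)"

text \<open>
  \<^locale>\<open>Metric_space\<close> requires nonnegativity and symmetry on the whole type, not only on the
  underlying set; hence the value \<open>0\<close> outside the carrier.
\<close>

definition padic_dist :: "nat \<Rightarrow> (nat \<Rightarrow> rat) set \<Rightarrow> (nat \<Rightarrow> rat) set \<Rightarrow> real" where
  "padic_dist p x y =
     (if x \<in> carrier (padic_field p) \<and> y \<in> carrier (padic_field p)
      then padic_abs p (x \<ominus>\<^bsub>padic_field p\<^esub> y) else 0)"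

definition padic_sphere :: "nat \<Rightarrow> real \<Rightarrow> (nat \<Rightarrow> rat) set \<Rightarrow> (nat \<Rightarrow> rat) set set" where
  "padic_sphere p r a =
     {x \<in> carrier (padic_field p). padic_abs p (x \<ominus>\<^bsub>padic_field p\<^esub> a) = r}"

text \<open>
  Being a continuous self-map of a compact metric space is part of the notion;
  \<^const>\<open>continuous_map\<close> includes that \<open>f\<close> maps \<open>X\<close> into itself.
\<close>

definition minimal_map :: "'a set \<Rightarrow> ('a \<Rightarrow> 'a \<Rightarrow> real) \<Rightarrow> ('a \<Rightarrow> 'a) \<Rightarrow> bool" where
  "minimal_map X d f \<longleftrightarrow>
     Metric_space X d \<and>
     compact_space (Metric_space.mtopology X d) \<and>
     continuous_map (Metric_space.mtopology X d) (Metric_space.mtopology X d) f \<and>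
     (\<forall>x\<in>X. Metric_space.mtopology X d closure_of {(f ^^ N) x | N. True} = X)"

definition generates_units_mod :: "nat \<Rightarrow> nat \<Rightarrow> bool" where
  "generates_units_mod m n \<longleftrightarrow>
     int n mod int m \<in> carrier (units_of (residue_ring (int m))) \<and>
     generate (units_of (residue_ring (int m))) {int n mod int m}
       = carrier (units_of (residue_ring (int m)))"

end

theory Submission
  imports Defs
begin

text \<open>
  The \<open>p\<close>-adic logarithm would identify the sphere of radius \<open>p ^ (- l)\<close> around \<open>1\<close> with the set
  of \<open>p\<close>-adic integers of absolute value \<open>p ^ (- l)\<close>, turning \<open>x \<mapsto> x\<^sup>n\<close> into multiplication by \<open>n\<close>.
  Dividing by \<open>p ^ l\<close>, minimality says that the powers of \<open>n\<close> are dense in the \<open>p\<close>-adic units,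
  that is, that \<open>n\<close> generates the units modulo every power of \<open>p\<close>; for odd \<open>p\<close> this is
  decided modulo \<open>p\<^sup>2\<close>.

  The proof follows this idea without constructing the logarithm. Integers are dense in the ring of
  \<open>p\<close>-adic integers and taking powers does not increase distances there, so minimality is
  equivalent to a statement about integers (\<open>minimal_map_iff_int\<close>): whenever \<open>a - 1\<close> and \<open>b - 1\<close> are
  divisible by exactly \<open>p ^ l\<close>, some \<open>a ^ (n ^ N)\<close> is congruent to \<open>b\<close> modulo any given power of \<open>p\<close>.
  The role of the logarithm is taken by two consequences of lifting the exponent: congruence of powers of
  \<open>a\<close> modulo \<open>p ^ (l + j)\<close> is congruence of the exponents modulo \<open>p ^ j\<close>
  (\<open>cong_power_iff_cong_exponent\<close>), and powers of \<open>a\<close> approximate every \<open>b\<close> congruent to \<open>1\<close>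
  modulo \<open>p ^ l\<close> (\<open>powers_cover_principal_units\<close>).

  If \<open>n\<close> generates the units modulo \<open>p\<^sup>2\<close>, it does so modulo all powers of \<open>p\<close>
  (\<open>generator_mod_square_lifts\<close>), and writing \<open>b\<close> as a power of \<open>a\<close> finishes this direction
  (\<open>power_orbit_cover\<close>). Conversely, for \<open>m\<close> prime to \<open>p\<close>, an orbit point of \<open>a\<close> that agrees with
  \<open>a ^ m\<close> modulo \<open>p ^ (l + 2)\<close> exhibits \<open>m\<close> as a power of \<open>n\<close> modulo \<open>p\<^sup>2\<close>.

  The remaining conditions in \<^const>\<open>minimal_map\<close>, among them compactness of the sphere, are proved from
  the construction of the field as a completion: the sphere is complete, and covered by
  finitely many small balls around integers.
\<close>

section \<open>Lifting the exponent\<close>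

definition exact_power_dvd :: "int \<Rightarrow> nat \<Rightarrow> int \<Rightarrow> bool" where
  "exact_power_dvd p l x \<longleftrightarrow> p ^ l dvd x \<and> \<not> p ^ Suc l dvd x"

lemma exact_power_dvd_mult_coprime:
  fixes p :: int
  assumes "exact_power_dvd p l x" and "prime p" and "\<not> p dvd s"
  shows "exact_power_dvd p l (x * s)"
proof -
  have "coprime (p ^ Suc l) s"
    using assms(2,3) by (simp add: prime_imp_coprime)
  then show ?thesis
    using assms(1) unfolding exact_power_dvd_def
    by (metis coprime_dvd_mult_left_iff dvd_mult2)
qed

lemma power_diff_1_eq_sum:
  fixes a :: int
  shows "a ^ m - 1 = (a - 1) * (\<Sum>i<m. a ^ i)"
  by (simp add: power_diff_1_eq)

lemma sum_powers_cong:
  fixes a p :: int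
  assumes "[a = 1] (mod p)"
  shows "[(\<Sum>i<m. a ^ i) = int m] (mod p)"
proof -
  have "[(\<Sum>i<m. a ^ i) = (\<Sum>i<m. 1 ^ i)] (mod p)"
    by (intro cong_sum cong_pow assms)
  then show ?thesis by simp
qed

lemma exact_power_dvd_imp_dvd:
  assumes "l \<ge> 1" and "exact_power_dvd p l x"
  shows "p dvd x"
  using assms unfolding exact_power_dvd_def
  by (metis dvd_power dvd_trans less_le_trans zero_less_one)

lemma exact_power_dvd_imp_not_dvd:
  assumes "prime p" and "l \<ge> 1" and "exact_power_dvd (int p) l (a - 1)"
  shows "\<not> int p dvd a"
proof
  assume "int p dvd a"
  then have "int p dvd a - (a - 1)"
    using exact_power_dvd_imp_dvd[OF assms(2,3)] by (rule dvd_diff)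
  with assms(1) show False by simp
qed

text \<open>
  Since \<open>a\<close> is \<open>1\<close> modulo \<open>p\<close>, the cofactor \<open>1 + a + \<dots> + a ^ (m - 1)\<close> of \<open>a - 1\<close> is
  congruent to \<open>m\<close>, hence prime to \<open>p\<close>.
\<close>
lemma exact_power_dvd_power_coprime:
  fixes a :: int
  assumes "prime p" and "l \<ge> 1" and "exact_power_dvd (int p) l (a - 1)" and "\<not> p dvd m"
  shows "exact_power_dvd (int p) l (a ^ m - 1)"
proof -
  have "int p dvd a - 1"
    by (rule exact_power_dvd_imp_dvd[OF assms(2,3)])
  then have "[a = 1] (mod int p)" by (simp add: cong_iff_dvd_diff)
  from sum_powers_cong[OF this] have "\<not> int p dvd (\<Sum>i<m. a ^ i)"
    using assms(4) by (metis cong_dvd_iff int_dvd_int_iff)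
  then show ?thesis
    using exact_power_dvd_mult_coprime[OF assms(3)] assms(1) by (simp add: power_diff_1_eq_sum)
qed

text \<open>
  The binomial expansion to first order in \<open>q\<close>. The factor \<open>2\<close> avoids the division in
  \<open>m (m - 1) / 2\<close>.
\<close>
lemma sum_powers_1_plus_cong:
  fixes t q :: int
  shows "[2 * (\<Sum>i<m. (1 + q * t) ^ i) = 2 * int m + q * t * (int m * (int m - 1))] (mod q\<^sup>2)"
proof (induction m)
  case 0
  then show ?case by simp
next
  case (Suc m)
  have pw: "[(1 + q * t) ^ m = 1 + int m * (q * t)] (mod q\<^sup>2)"
  proof (induction m)
    case (Suc m)
    have "[(1 + q * t) * (1 + q * t) ^ m = (1 + q * t) * (1 + int m * (q * t))] (mod q\<^sup>2)"
      by (intro cong_mult Suc cong_refl)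
    also have "(1 + q * t) * (1 + int m * (q * t)) = 1 + int (Suc m) * (q * t) + q\<^sup>2 * (int m * t\<^sup>2)"
      by (simp add: algebra_simps power2_eq_square)
    also have "[\<dots> = 1 + int (Suc m) * (q * t)] (mod q\<^sup>2)"
      by (simp add: cong_iff_dvd_diff)
    finally show ?case by simp
  qed simp
  have "[2 * (\<Sum>i<m. (1 + q * t) ^ i) + 2 * (1 + q * t) ^ m =
      (2 * int m + q * t * (int m * (int m - 1))) + 2 * (1 + int m * (q * t))] (mod q\<^sup>2)"
    by (intro cong_add Suc cong_mult pw cong_refl)
  then show ?case by (simp add: algebra_simps)
qed

text \<open>
  This is the step that fails for \<open>p = 2\<close>. Writing \<open>a = 1 + p t\<close>, the cofactor of \<open>a - 1\<close> in
  \<open>a ^ p - 1\<close> is \<open>p + p t \<cdot> p (p - 1) / 2\<close> modulo \<open>p\<^sup>2\<close>, and for odd \<open>p\<close> the second summand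
  is divisible by \<open>p\<^sup>2\<close>, so the cofactor contains exactly one factor \<open>p\<close>.
\<close>
lemma exact_power_dvd_power_prime:
  fixes a :: int
  assumes "prime p" and "p \<noteq> 2" and "l \<ge> 1" and "exact_power_dvd (int p) l (a - 1)"
  shows "exact_power_dvd (int p) (Suc l) (a ^ p - 1)"
proof -
  let ?p = "int p"
  have "?p dvd a - 1"
    by (rule exact_power_dvd_imp_dvd[OF assms(3,4)])
  then obtain t where t: "a = 1 + ?p * t" by (metis add.commute diff_add_cancel dvdE)
  have p0: "?p > 0" using assms(1) by (simp add: prime_gt_0_nat)
  define S where "S = (\<Sum>i<p. a ^ i)"
  have c: "[2 * S = 2 * ?p + ?p * t * (?p * (?p - 1))] (mod ?p\<^sup>2)"
    unfolding S_def t by (rule sum_powers_1_plus_cong)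
  have "[2 * ?p + ?p * t * (?p * (?p - 1)) = 2 * ?p] (mod ?p\<^sup>2)"
    by (simp add: cong_iff_dvd_diff power2_eq_square)
  with c have "?p\<^sup>2 dvd 2 * S - 2 * ?p" by (metis cong_iff_dvd_diff cong_trans)
  then have "?p\<^sup>2 dvd 2 * (S - ?p)" by (simp add: algebra_simps)
  moreover have "coprime (?p\<^sup>2) 2"
    using assms(1,2) by (metis coprime_commute coprime_power_left_iff primes_coprime prime_int_nat_transfer
        nat_int two_is_prime_nat of_nat_numeral coprime_int_iff)
  ultimately have "?p\<^sup>2 dvd S - ?p" using coprime_dvd_mult_right_iff by blast
  then obtain w where "S - ?p = ?p\<^sup>2 * w" by blast
  then have S: "S = ?p * (1 + ?p * w)" by (simp add: algebra_simps power2_eq_square)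
  have "\<not> ?p dvd 1 + ?p * w"
    using prime_gt_1_nat[OF assms(1)] by (simp add: dvd_add_left_iff)
  from exact_power_dvd_mult_coprime[OF assms(4) _ this]
  have "exact_power_dvd ?p l ((a - 1) * (1 + ?p * w))" using assms(1) by simp
  moreover have "a ^ p - 1 = ?p * ((a - 1) * (1 + ?p * w))"
    using S unfolding S_def by (simp add: power_diff_1_eq_sum)
  ultimately show ?thesis using p0 unfolding exact_power_dvd_def by simp
qed

lemma exact_power_dvd_power_prime_power:
  fixes a :: int
  assumes "prime p" and "p \<noteq> 2" and "l \<ge> 1" and "exact_power_dvd (int p) l (a - 1)"
  shows "exact_power_dvd (int p) (l + i) (a ^ (p ^ i) - 1)"
proof (induction i)
  case (Suc i)
  from exact_power_dvd_power_prime[OF assms(1,2) _ Suc] assms(3)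
  show ?case by (simp add: power_mult[symmetric] mult.commute)
qed (use assms in simp)

text \<open>
  Lifting the exponent: raising to a power prime to \<open>p\<close> keeps the valuation of \<open>a - 1\<close>, and
  raising to the power \<open>p\<close> increases it by one.
\<close>
lemma power_dvd_power_diff_1_iff:
  fixes a :: int
  assumes "prime p" and "p \<noteq> 2" and "l \<ge> 1" and "exact_power_dvd (int p) l (a - 1)"
  shows "int p ^ (l + j) dvd a ^ m - 1 \<longleftrightarrow> p ^ j dvd m"
proof (cases "m = 0")
  case False
  obtain i r where m: "m = p ^ i * r" and r: "\<not> p dvd r"
    using multiplicity_decompose'[of m p] False assms(1)
    by (metis not_prime_unit)
  have "exact_power_dvd (int p) (l + i) ((a ^ (p ^ i)) ^ r - 1)"
    using exact_power_dvd_power_coprime[OF assms(1) _ exact_power_dvd_power_prime_power[OF assms] r] assms(3)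
    by simp
  then have e: "exact_power_dvd (int p) (l + i) (a ^ m - 1)" by (simp add: m power_mult)
  have "int p ^ (l + j) dvd a ^ m - 1 \<longleftrightarrow> j \<le> i"
    using e unfolding exact_power_dvd_def
    by (metis add_le_cancel_left dvd_trans le_imp_power_dvd not_less_eq_eq add_Suc_right)
  also have "\<dots> \<longleftrightarrow> p ^ j dvd m"
  proof
    assume "p ^ j dvd m"
    then show "j \<le> i"
      unfolding m using r assms(1)
      by (metis coprime_dvd_mult_left_iff coprime_power_left_iff not_prime_unit power_dvd_imp_le prime_gt_1_nat prime_imp_coprime)
  qed (simp add: m le_imp_power_dvd)
  finally show ?thesis .
qed simp

text \<open>
  This replaces the \<open>p\<close>-adic logarithm: up to the shift by \<open>l\<close>, powers of \<open>a\<close> are exactly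
  as close to each other as their exponents.
\<close>
lemma cong_power_iff_cong_exponent:
  fixes a :: int
  assumes "prime p" and "p \<noteq> 2" and "l \<ge> 1" and "exact_power_dvd (int p) l (a - 1)"
  shows "[a ^ m = a ^ m'] (mod int p ^ (l + j)) \<longleftrightarrow> [m = m'] (mod p ^ j)"
proof -
  have *: "[a ^ m = a ^ m'] (mod int p ^ (l + j)) \<longleftrightarrow> [m = m'] (mod p ^ j)" if "m' \<le> m" for m m'
  proof -
    have "\<not> int p dvd a"
      by (rule exact_power_dvd_imp_not_dvd[OF assms(1,3,4)])
    then have cop: "coprime (int p ^ (l + j)) (a ^ m')"
      using assms(1) by (simp add: prime_imp_coprime)
    have "a ^ m - a ^ m' = a ^ m' * (a ^ (m - m') - 1)"
      using that by (simp add: algebra_simps flip: power_add)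
    then have "[a ^ m = a ^ m'] (mod int p ^ (l + j)) \<longleftrightarrow> int p ^ (l + j) dvd a ^ (m - m') - 1"
      using cop by (simp add: cong_iff_dvd_diff coprime_dvd_mult_right_iff)
    also have "\<dots> \<longleftrightarrow> p ^ j dvd m - m'" by (rule power_dvd_power_diff_1_iff[OF assms])
    also have "\<dots> \<longleftrightarrow> [m = m'] (mod p ^ j)"
      using that cong_altdef_nat[of m' m "p ^ j"] by blast
    finally show ?thesis .
  qed
  show ?thesis using *[of m m'] *[of m' m] by (metis cong_sym_eq nat_le_linear)
qed

text \<open>
  Successive approximation. If \<open>a ^ m\<close> agrees with \<open>b\<close> modulo \<open>p ^ (l + i)\<close>, multiplying by a power
  of \<open>a ^ (p ^ i)\<close>, which is \<open>1 + p ^ (l + i) u\<close> with \<open>u\<close> prime to \<open>p\<close>, corrects the next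
  digit, because \<open>u\<close> is invertible modulo \<open>p\<close>.
\<close>
lemma powers_cover_principal_units:
  fixes a b :: int
  assumes "prime p" and "p \<noteq> 2" and "l \<ge> 1" and "exact_power_dvd (int p) l (a - 1)"
    and "[b = 1] (mod int p ^ l)"
  shows "\<exists>m. [a ^ m = b] (mod int p ^ (l + i))"
proof (induction i)
  case 0
  show ?case by (rule exI[of _ 0]) (use assms(5) cong_sym in auto)
next
  case (Suc i)
  then obtain m where m: "[a ^ m = b] (mod int p ^ (l + i))" by blast
  let ?P = "int p ^ (l + i)"
  obtain c where c: "b - a ^ m = ?P * c" using m by (metis cong_iff_dvd_diff cong_sym dvdE)
  have ex: "exact_power_dvd (int p) (l + i) (a ^ (p ^ i) - 1)"
    by (rule exact_power_dvd_power_prime_power[OF assms(1-4)])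
  then obtain u where u: "a ^ (p ^ i) - 1 = ?P * u" unfolding exact_power_dvd_def by blast
  have nu: "\<not> int p dvd u"
    using ex u unfolding exact_power_dvd_def by (auto simp: mult.commute)
  have "\<not> int p dvd a"
    by (rule exact_power_dvd_imp_not_dvd[OF assms(1,3,4)])
  with nu have "coprime (u * a ^ m) (int p)"
    using assms(1) prime_imp_coprime[of "int p"] by (simp add: coprime_commute)
  then obtain s0 where "[u * a ^ m * s0 = 1] (mod int p)" using cong_solve_coprime_int by blast
  then have "[u * a ^ m * s0 * c = 1 * c] (mod int p)" by (rule cong_scalar_right)
  \<comment> \<open>The exponent \<open>s\<close> is chosen with \<open>u a\<^sup>m s = c\<close> modulo \<open>p\<close>, so that it removes the error \<open>c\<close>.\<close>
  define s where "s = nat ((s0 * c) mod int p)"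
  have "[int s = s0 * c] (mod int p)"
    using assms(1) unfolding s_def by (simp add: prime_gt_0_nat cong_def)
  then have "[u * a ^ m * int s = u * a ^ m * (s0 * c)] (mod int p)" by (rule cong_scalar_left)
  with \<open>[u * a ^ m * s0 * c = 1 * c] (mod int p)\<close> have sc: "[u * a ^ m * int s = c] (mod int p)"
    by (metis cong_trans mult.assoc mult_1)
  have P2: "int p ^ (l + Suc i) dvd ?P * ?P"
    unfolding power_add[symmetric] by (rule le_imp_power_dvd) (use assms(3) in simp)
  have pw: "[(1 + ?P * u) ^ s = 1 + int s * (?P * u)] (mod int p ^ (l + Suc i))" for s
  proof (induction s)
    case (Suc s)
    have "[(1 + ?P * u) * (1 + ?P * u) ^ s = (1 + ?P * u) * (1 + int s * (?P * u))] (mod int p ^ (l + Suc i))"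
      by (intro cong_mult Suc cong_refl)
    also have "(1 + ?P * u) * (1 + int s * (?P * u)) = 1 + int (Suc s) * (?P * u) + ?P * ?P * (int s * u\<^sup>2)"
      by (simp add: algebra_simps power2_eq_square)
    also have "[\<dots> = 1 + int (Suc s) * (?P * u)] (mod int p ^ (l + Suc i))"
      using P2 by (simp add: cong_iff_dvd_diff)
    finally show ?case by simp
  qed simp
  have "a ^ (p ^ i) = 1 + ?P * u" using u by simp
  then have "a ^ (m + p ^ i * s) = a ^ m * (1 + ?P * u) ^ s"
    by (metis power_add power_mult)
  also have "[a ^ m * (1 + ?P * u) ^ s = a ^ m * (1 + int s * (?P * u))] (mod int p ^ (l + Suc i))"
    by (intro cong_mult pw cong_refl)
  also have "a ^ m * (1 + int s * (?P * u)) = a ^ m + ?P * (u * a ^ m * int s)"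
    by (simp add: algebra_simps)
  also have "[\<dots> = a ^ m + ?P * c] (mod int p ^ (l + Suc i))"
    using mult_dvd_mono[OF dvd_refl[of ?P] sc[unfolded cong_iff_dvd_diff]]
    unfolding cong_iff_dvd_diff by (simp add: algebra_simps)
  also have "a ^ m + ?P * c = b" using c by simp
  finally show ?case by blast
qed

text \<open>
  The power \<open>h = n ^ (p - 1)\<close> is \<open>1\<close> modulo \<open>p\<close>, but not modulo \<open>p\<^sup>2\<close>: otherwise every unit
  modulo \<open>p\<^sup>2\<close> would have order dividing \<open>p - 1\<close>, which fails for \<open>1 + p\<close>. So the powers of \<open>h\<close>
  cover all units congruent to \<open>1\<close> modulo \<open>p\<close>, and a power of \<open>n\<close> moves any unit into this
  class.
\<close>
lemma generator_mod_square_lifts: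
  fixes b :: int
  assumes "prime p" and "p \<noteq> 2" and "coprime n p"
    and gen: "\<And>c. coprime c (int p) \<Longrightarrow> \<exists>N. [int n ^ N = c] (mod int p ^ 2)"
    and b: "coprime b (int p)"
  shows "\<exists>N. [int n ^ N = b] (mod int p ^ k)"
proof -
  let ?p = "int p" and ?n = "int n"
  have p1: "p > 1" using assms(1) prime_gt_1_nat by blast
  define h where "h = ?n ^ (p - 1)"
  have npd: "\<not> p dvd n"
    using assms(1,3) by (metis coprime_commute coprime_absorb_left not_prime_unit)
  have h1: "[h = 1] (mod ?p)"
    using fermat_theorem[OF assms(1) npd] unfolding h_def
    by (metis cong_int_iff of_nat_1 of_nat_power)
  have h2: "\<not> [h = 1] (mod ?p ^ 2)"
  proof
    assume hh: "[h = 1] (mod ?p ^ 2)"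
    have "coprime (1 + ?p) ?p" using coprime_add_one_left[of ?p] by (simp add: add.commute)
    then obtain N where N: "[?n ^ N = 1 + ?p] (mod ?p ^ 2)" using gen by blast
    have "[(?n ^ N) ^ (p - 1) = (1 + ?p) ^ (p - 1)] (mod ?p ^ 2)" by (rule cong_pow[OF N])
    moreover have "(?n ^ N) ^ (p - 1) = h ^ N" by (simp add: h_def mult.commute flip: power_mult)
    moreover have "[h ^ N = 1 ^ N] (mod ?p ^ 2)" by (rule cong_pow[OF hh])
    ultimately have "[(1 + ?p) ^ (p - 1) = 1] (mod ?p ^ 2)" by (metis cong_sym cong_trans power_one)
    moreover have "exact_power_dvd ?p 1 ((1 + ?p) - 1)"
      using p1 unfolding exact_power_dvd_def by (auto simp: zdvd_not_zless)
    from power_dvd_power_diff_1_iff[OF assms(1,2) _ this, of 1 "p - 1"]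
    have "\<not> ?p ^ 2 dvd (1 + ?p) ^ (p - 1) - 1"
      using p1 by (auto simp: numeral_2_eq_2 dvd_imp_le nat_dvd_not_less)
    ultimately show False by (simp add: cong_iff_dvd_diff)
  qed
  have ex: "exact_power_dvd ?p 1 (h - 1)"
    using h1 h2 unfolding exact_power_dvd_def by (simp add: cong_iff_dvd_diff numeral_2_eq_2)
  obtain i where "[?n ^ i = b] (mod ?p ^ 2)" using gen[OF b] by blast
  then have i: "[b = ?n ^ i] (mod ?p)"
    by (metis cong_dvd_modulus cong_sym dvd_power zero_less_numeral)
  \<comment> \<open>Modulo \<open>p\<close>, the factor \<open>?n ^ (i * (p - 2))\<close> is the inverse of \<open>?n ^ i\<close>, hence of \<open>b\<close>.\<close>
  have "[b * ?n ^ (i * (p - 2)) = ?n ^ i * ?n ^ (i * (p - 2))] (mod ?p)"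
    by (rule cong_scalar_right[OF i])
  also have "?n ^ i * ?n ^ (i * (p - 2)) = h ^ i"
  proof -
    have "i + i * (p - 2) = (p - 1) * i"
      using p1 by (metis (no_types, lifting) One_nat_def Suc_diff_Suc Suc_1 diff_Suc_1 mult.commute mult_Suc_right numeral_2_eq_2 One_nat_def)
    then show ?thesis by (simp add: h_def flip: power_mult power_add)
  qed
  also have "[h ^ i = 1 ^ i] (mod ?p)" by (rule cong_pow[OF h1])
  finally have "[b * ?n ^ (i * (p - 2)) = 1] (mod ?p ^ 1)" by simp
  from powers_cover_principal_units[OF assms(1,2) _ ex this, of k]
  obtain j where j: "[h ^ j = b * ?n ^ (i * (p - 2))] (mod ?p ^ (1 + k))" by auto
  have "[h ^ (p ^ k) = 1] (mod ?p ^ (1 + k))"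
    using exact_power_dvd_power_prime_power[OF assms(1,2) _ ex, of k]
    by (simp add: exact_power_dvd_def cong_iff_dvd_diff)
  from cong_pow[OF this, of i] have hk: "[h ^ (p ^ k * i) = 1] (mod ?p ^ (1 + k))"
    by (simp add: power_mult)
  \<comment> \<open>The factor \<open>?n ^ (i * (p - 2))\<close> is now cancelled by completing its exponent to that of
    \<open>h ^ (p ^ k * i)\<close>, which is \<open>1\<close> modulo \<open>p ^ (1 + k)\<close>.\<close>
  have le: "i * (p - 2) \<le> p ^ k * (p - 1) * i"
  proof -
    have "p - 2 \<le> p ^ k * (p - 1)"
      using p1 by (metis One_nat_def diff_le_mono2 le_trans mult_le_mono1 nat_mult_1 one_le_numeral one_le_power less_imp_le)
    then show ?thesis by (metis mult.commute mult_le_mono1)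
  qed
  have "[?n ^ ((p - 1) * j + (p ^ k * (p - 1) * i - i * (p - 2))) 
      = h ^ j * ?n ^ (p ^ k * (p - 1) * i - i * (p - 2))] (mod ?p ^ (1 + k))"
    by (simp add: h_def power_add power_mult)
  also have "[h ^ j * ?n ^ (p ^ k * (p - 1) * i - i * (p - 2)) 
      = b * ?n ^ (i * (p - 2)) * ?n ^ (p ^ k * (p - 1) * i - i * (p - 2))] (mod ?p ^ (1 + k))"
    by (rule cong_scalar_right[OF j])
  also have "b * ?n ^ (i * (p - 2)) * ?n ^ (p ^ k * (p - 1) * i - i * (p - 2)) = b * h ^ (p ^ k * i)"
    using le by (simp add: h_def mult.assoc mult.left_commute flip: power_add power_mult)
  also have "[b * h ^ (p ^ k * i) = b * 1] (mod ?p ^ (1 + k))"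
    by (rule cong_scalar_left[OF hk])
  finally have "[?n ^ ((p - 1) * j + (p ^ k * (p - 1) * i - i * (p - 2))) = b] (mod ?p ^ (1 + k))"
    by simp
  then show ?thesis by (metis cong_dvd_modulus le_add2 le_imp_power_dvd)
qed

text \<open>
  In a finite group inverses are powers, so the subgroup generated by \<open>n\<close> consists of the powers
  with exponents in \<^typ>\<open>nat\<close>; this is why a forward orbit suffices.
\<close>
lemma generates_units_mod_iff:
  assumes "prime p" and "coprime n p"
  shows "generates_units_mod (p ^ 2) n \<longleftrightarrow>
    (\<forall>c. coprime c (int p) \<longrightarrow> (\<exists>N. [int n ^ N = c] (mod int p ^ 2)))"
proof -
  let ?m = "int (p ^ 2)"
  let ?R = "residue_ring ?m"
  have m1: "?m > 1" using assms(1) prime_gt_1_nat[of p] by (simp add: one_less_power)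
  interpret R: residues ?m ?R by unfold_locales (use m1 in auto)
  interpret U: group "units_of ?R" by (rule R.units_group)
  have mp: "?m = int p ^ 2" by simp
  have cop: "coprime c ?m \<longleftrightarrow> coprime c (int p)" for c by simp
  have nin: "int n mod ?m \<in> carrier (units_of ?R)"
    using R.mod_in_res_units[OF m1, of "int n"] assms(2) by (simp add: units_of_carrier cop)
  have powU: "(int n mod ?m) [^]\<^bsub>units_of ?R\<^esub> N = int n ^ N mod ?m" for N :: nat
    using R.units_of_pow nin R.pow_cong by (simp add: units_of_carrier)
  have "generate (units_of ?R) {int n mod ?m} = {int n ^ N mod ?m | N. True}"
    using U.generate_pow_on_finite_carrier[OF _ nin] R.finite_Units
    unfolding powU units_of_carrier by auto
  moreover have "{int n ^ N mod ?m | N. True} \<subseteq> carrier (units_of ?R)"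
    using U.nat_pow_closed[OF nin] unfolding powU by blast
  ultimately have "generates_units_mod (p ^ 2) n \<longleftrightarrow>
      carrier (units_of ?R) \<subseteq> {int n ^ N mod ?m | N. True}"
    unfolding generates_units_mod_def using nin by blast
  also have "\<dots> \<longleftrightarrow> (\<forall>c. coprime c (int p) \<longrightarrow> (\<exists>N. [int n ^ N = c] (mod int p ^ 2)))"
  proof safe
    fix c assume *: "carrier (units_of ?R) \<subseteq> {int n ^ N mod ?m | N. True}" and "coprime c (int p)"
    then have "c mod ?m \<in> carrier (units_of ?R)"
      using R.mod_in_res_units[OF m1, of c] by (simp add: units_of_carrier cop)
    with * obtain N where "c mod ?m = int n ^ N mod ?m" by blast
    then show "\<exists>N. [int n ^ N = c] (mod int p ^ 2)" by (metis cong_def mp)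
  next
    fix c assume *: "\<forall>c. coprime c (int p) \<longrightarrow> (\<exists>N. [int n ^ N = c] (mod int p ^ 2))"
      and "c \<in> carrier (units_of ?R)"
    then have "c \<in> {c. 0 < c \<and> c < ?m \<and> coprime c ?m}"
      unfolding units_of_carrier R.res_units_eq by blast
    then have "0 < c" "c < ?m" "coprime c (int p)"
      unfolding cop by blast+
    with * show "\<exists>N. c = int n ^ N mod ?m \<and> True"
      by (metis cong_def mod_pos_pos_trivial mp order_less_imp_le)
  qed
  finally show ?thesis .
qed

text \<open>
  Some power \<open>a ^ m\<close> is close to \<open>b\<close>. As \<open>b - 1\<close> has the same valuation as \<open>a - 1\<close>, the exponent
  \<open>m\<close> is prime to \<open>p\<close>, so it is close to a power of \<open>n\<close>.
\<close>
lemma power_orbit_cover: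
  fixes a b :: int
  assumes "prime p" and "p \<noteq> 2" and "l \<ge> 1" and "coprime n p"
    and gen: "generates_units_mod (p ^ 2) n"
    and a: "exact_power_dvd (int p) l (a - 1)" and b: "exact_power_dvd (int p) l (b - 1)"
  shows "\<exists>N. [a ^ (n ^ N) = b] (mod int p ^ k)"
proof -
  have "[b = 1] (mod int p ^ l)" using b by (simp add: exact_power_dvd_def cong_iff_dvd_diff)
  from powers_cover_principal_units[OF assms(1-3) a this]
  obtain m where m: "[a ^ m = b] (mod int p ^ (l + Suc k))" by blast
  have "\<not> p dvd m"
  proof
    assume "p dvd m"
    then have "int p ^ (l + 1) dvd a ^ m - 1"
      using power_dvd_power_diff_1_iff[OF assms(1-3) a, of 1 m] by simp
    moreover have "[a ^ m = b] (mod int p ^ (l + 1))"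
      using m by (rule cong_dvd_modulus) (simp add: le_imp_power_dvd)
    ultimately have "int p ^ (l + 1) dvd b - 1"
      by (metis cong_iff_dvd_diff cong_sym cong_trans)
    with b show False by (simp add: exact_power_dvd_def)
  qed
  then have "coprime (int m) (int p)"
    using prime_imp_coprime[OF assms(1)] by (simp add: coprime_commute)
  then obtain N where N: "[int n ^ N = int m] (mod int p ^ Suc k)"
    using generator_mod_square_lifts[OF assms(1,2,4)] gen[unfolded generates_units_mod_iff[OF assms(1,4)]]
    by blast
  then have "[n ^ N = m] (mod p ^ Suc k)" by (metis cong_int_iff of_nat_power)
  then have "[a ^ (n ^ N) = b] (mod int p ^ (l + Suc k))"
    using cong_power_iff_cong_exponent[OF assms(1-3) a] m cong_trans by blast
  then have "[a ^ (n ^ N) = b] (mod int p ^ k)"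
    by (rule cong_dvd_modulus) (simp add: le_imp_power_dvd)
  then show ?thesis by blast
qed

section \<open>The absolute value on the rationals\<close>

locale padic =
  fixes p :: nat
  assumes p: "prime p"
begin

abbreviation v :: "rat \<Rightarrow> real" where "v \<equiv> rat_padic_abs p"

lemma p_gt_1: "1 < real p"
  using prime_gt_1_nat[OF p] by simp

lemma v_0 [simp]: "v 0 = 0"
  by (simp add: rat_padic_abs_def)

lemma v_divide_int:
  assumes "a \<noteq> 0" and "b \<noteq> 0"
  shows "v (of_int a / of_int b) = real p powi (int (multiplicity (int p) b) - int (multiplicity (int p) a))"
proof -
  obtain c d where q: "quotient_of (of_int a / of_int b) = (c, d)" by force
  have d: "d > 0" using quotient_of_denom_pos[OF q] .
  have eq: "of_int a / of_int b = (of_int c / of_int d :: rat)" by (rule quotient_of_div[OF q])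
  then have "(of_int (a * d) :: rat) = of_int (c * b)" using assms d by (simp add: field_simps)
  then have ad: "a * d = c * b" by (simp only: of_int_eq_iff)
  then have c: "c \<noteq> 0" using assms d by auto
  have pe: "prime_elem (int p)" using p by simp
  have "multiplicity (int p) (a * d) = multiplicity (int p) (c * b)" by (simp add: ad)
  then have "multiplicity (int p) a + multiplicity (int p) d = multiplicity (int p) c + multiplicity (int p) b"
    using assms c d by (simp add: prime_elem_multiplicity_mult_distrib[OF pe])
  then have "int (multiplicity (int p) d) - int (multiplicity (int p) c)
    = int (multiplicity (int p) b) - int (multiplicity (int p) a)" by linarith
  then show ?thesis using assms by (simp add: rat_padic_abs_def q)
qed

lemma v_int: "a \<noteq> 0 \<Longrightarrow> v (of_int a) = real p powi (- int (multiplicity (int p) a))"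
  using v_divide_int[of a 1] by simp

lemma rat_as_int_quotient:
  fixes x :: rat
  obtains a b where "x = of_int a / of_int b" "b \<noteq> 0"
  by (metis quotient_of_div quotient_of_denom_pos less_irrefl prod.exhaust)

lemma v_eq_0_iff [simp]: "v x = 0 \<longleftrightarrow> x = 0"
  using p_gt_1 by (simp add: rat_padic_abs_def)

lemma v_nonneg [simp]: "v x \<ge> 0"
  by (simp add: rat_padic_abs_def)

lemma v_mult: "v (x * y) = v x * v y"
proof (cases "x = 0 \<or> y = 0")
  case False
  obtain a b where x: "x = of_int a / of_int b" "b \<noteq> 0" by (rule rat_as_int_quotient)
  obtain c d where y: "y = of_int c / of_int d" "d \<noteq> 0" by (rule rat_as_int_quotient)
  have nz: "a \<noteq> 0" "c \<noteq> 0" using False x y by auto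
  have pe: "prime_elem (int p)" using p by simp
  have "x * y = of_int (a * c) / of_int (b * d)" by (simp add: x y)
  then have "v (x * y) = real p powi (int (multiplicity (int p) (b * d)) - int (multiplicity (int p) (a * c)))"
    using v_divide_int[of "a * c" "b * d"] nz x y by simp
  also have "\<dots> = real p powi ((int (multiplicity (int p) b) - int (multiplicity (int p) a)) +
       (int (multiplicity (int p) d) - int (multiplicity (int p) c)))"
    using nz x y by (simp add: prime_elem_multiplicity_mult_distrib[OF pe] algebra_simps)
  also have "\<dots> = v x * v y"
    using nz x y p_gt_1 by (simp add: v_divide_int power_int_add)
  finally show ?thesis .
qed auto

lemma v_1 [simp]: "v 1 = 1"
  by (simp add: rat_padic_abs_def)

lemma v_minus [simp]: "v (- x) = v x"
proof -
  have "v (-1) * v (-1) = 1" using v_mult[of "-1" "-1"] by simp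
  then have "v (-1) = 1" using v_nonneg[of "-1"] by (simp add: square_eq_1_iff)
  then show ?thesis using v_mult[of "-1" x] by simp
qed

lemma v_int_le_iff: "v (of_int a) \<le> real p powi (- int k) \<longleftrightarrow> int p ^ k dvd a"
proof (cases "a = 0")
  case False
  have "v (of_int a) \<le> real p powi (- int k) \<longleftrightarrow> k \<le> multiplicity (int p) a"
    unfolding v_int[OF False]
    using power_int_strict_increasing[OF _ p_gt_1, of "- int k" "- int (multiplicity (int p) a)"]
      power_int_increasing[of "- int (multiplicity (int p) a)" "- int k" "real p"] p_gt_1
    by (cases "k \<le> multiplicity (int p) a") auto
  also have "\<dots> \<longleftrightarrow> int p ^ k dvd a"
    using False p by (subst power_dvd_iff_le_multiplicity) auto
  finally show ?thesis .
qed simp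

lemma v_int_le_1: "v (of_int a) \<le> 1"
  using v_int_le_iff[of a 0] by simp

text \<open>
  After passing to a common denominator, multiplicativity reduces the claim to integers, where
  it says that a power of \<open>p\<close> dividing both summands divides the sum.
\<close>
lemma v_add_le: "v (x + y) \<le> max (v x) (v y)"
proof -
  have int: "v (of_int (a + b)) \<le> max (v (of_int a)) (v (of_int b))" for a b :: int
  proof -
    have *: "v (of_int (a + b)) \<le> v (of_int b)" if le: "v (of_int a) \<le> v (of_int b)" for a b :: int
    proof (cases "b = 0")
      case True
      with le have "a = 0" by (metis order_antisym_conv of_int_0 of_int_eq_0_iff v_0 v_eq_0_iff v_nonneg)
      with True show ?thesis by simp
    next
      case False
      then have "int p ^ multiplicity (int p) b dvd a"
        using le v_int_le_iff by (metis v_int)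
      moreover have "int p ^ multiplicity (int p) b dvd b" by (rule multiplicity_dvd)
      ultimately show ?thesis
        using False v_int_le_iff by (metis dvd_add v_int)
    qed
    show ?thesis
      using *[of a b] *[of b a] by (cases "v (of_int a) \<le> v (of_int b)") (auto simp: add.commute max_def)
  qed
  obtain a b where x: "x = of_int a / of_int b" "b \<noteq> 0" by (rule rat_as_int_quotient)
  obtain c d where y: "y = of_int c / of_int d" "d \<noteq> 0" by (rule rat_as_int_quotient)
  let ?w = "v (1 / of_int (b * d))"
  have "x = of_int (a * d) * (1 / of_int (b * d))" "y = of_int (c * b) * (1 / of_int (b * d))"
    using x y by (simp_all add: field_simps)
  then have "v x = v (of_int (a * d)) * ?w" "v y = v (of_int (c * b)) * ?w"
    "v (x + y) = v (of_int (a * d + c * b)) * ?w"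
    by (metis v_mult, metis v_mult, metis v_mult distrib_right of_int_add)
  then show ?thesis
    using mult_right_mono[OF int[of "a * d" "c * b"], of ?w] by (simp add: max_mult_distrib_right)
qed

lemma v_diff_le: "v (x - y) \<le> max (v x) (v y)"
  using v_add_le[of x "- y"] by simp

lemma v_diff_commute: "v (x - y) = v (y - x)"
  by (metis minus_diff_eq v_minus)

lemma abs_v_diff_le: "\<bar>v x - v y\<bar> \<le> v (x - y)"
proof -
  have "v x \<le> v (x - y) + v y" for x y
    by (rule order_trans[OF v_add_le[of "x - y" y, simplified]]) simp
  from this[of x y] this[of y x]
  have "v x \<le> v (x - y) + v y" "v y \<le> v (y - x) + v x" .
  then show ?thesis by (auto simp: v_diff_commute)
qed

text \<open>
  In lowest terms the denominator of \<open>q\<close> is prime to \<open>p\<close>, hence invertible modulo \<open>p ^ k\<close>.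
\<close>
lemma v_le_1_int_approx:
  assumes "v q \<le> 1"
  shows "\<exists>a::int. v (q - of_int a) \<le> real p powi (- int k)"
proof -
  obtain s t where q: "quotient_of q = (s, t)" by force
  have t: "t > 0" using quotient_of_denom_pos[OF q] .
  have st: "coprime s t" using quotient_of_coprime[OF q] .
  have qe: "q = of_int s / of_int t" by (rule quotient_of_div[OF q])
  have "\<not> int p dvd t"
  proof
    assume dv: "int p dvd t"
    then have ns: "\<not> int p dvd s"
      using coprime_common_divisor[OF st, of "int p"] p by auto
    then have s0: "s \<noteq> 0" by auto
    have "v q = real p powi int (multiplicity (int p) t)"
      using v_divide_int[OF s0, of t] t ns by (simp add: qe not_dvd_imp_multiplicity_0)
    moreover have "multiplicity (int p) t \<ge> 1"
      using dv t p by (intro multiplicity_geI) auto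
    ultimately show False
      using assms one_less_power[OF p_gt_1, of "multiplicity (int p) t"] by simp
  qed
  then have tp: "coprime t (int p ^ k)"
    using p prime_imp_coprime[of "int p" t] by (simp add: coprime_commute)
  then obtain r where r: "[t * r = 1] (mod int p ^ k)" using cong_solve_coprime_int by blast
  have "int p ^ k dvd s * (1 - t * r)"
    using r by (metis cong_iff_dvd_diff cong_sym dvd_mult)
  then have le: "v (of_int (s * (1 - t * r))) \<le> real p powi (- int k)" by (simp only: v_int_le_iff)
  have vt: "v (of_int t) = 1"
    using v_int[of t] t \<open>\<not> int p dvd t\<close> by (simp add: not_dvd_imp_multiplicity_0)
  have "of_int (s * (1 - t * r)) = (q - of_int (s * r)) * of_int t"
    using t by (simp add: qe field_simps)
  then have "v (of_int (s * (1 - t * r))) = v (q - of_int (s * r))"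
    by (simp only: v_mult vt mult_1_right)
  with le show ?thesis by metis
qed

section \<open>Cauchy sequences and the absolute value on the completion\<close>

abbreviation "C \<equiv> padic_Cauchy_ring p"
abbreviation "I \<equiv> padic_null p"
abbreviation "Q \<equiv> padic_field p"

lemma C_simps:
  "carrier C = {f. padic_Cauchy p f}" "f \<otimes>\<^bsub>C\<^esub> g = (\<lambda>i. f i * g i)" "\<one>\<^bsub>C\<^esub> = (\<lambda>i. 1)"
  "\<zero>\<^bsub>C\<^esub> = (\<lambda>i. 0)" "f \<oplus>\<^bsub>C\<^esub> g = (\<lambda>i. f i + g i)"
  by (simp_all add: padic_Cauchy_ring_def)

lemma CauchyD:
  assumes "padic_Cauchy p f" and "e > 0"
  shows "\<exists>M. \<forall>i\<ge>M. \<forall>j\<ge>M. v (f i - f j) < e"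
  using assms by (simp add: padic_Cauchy_def)

lemma Cauchy_const: "padic_Cauchy p (\<lambda>i. c)"
  by (simp add: padic_Cauchy_def)

lemma Cauchy_add:
  assumes "padic_Cauchy p f" and "padic_Cauchy p g"
  shows "padic_Cauchy p (\<lambda>i. f i + g i)"
  unfolding padic_Cauchy_def
proof (intro allI impI)
  fix e :: real assume e: "e > 0"
  obtain M where M: "\<forall>i\<ge>M. \<forall>j\<ge>M. v (f i - f j) < e" using CauchyD[OF assms(1) e] by blast
  obtain N where N: "\<forall>i\<ge>N. \<forall>j\<ge>N. v (g i - g j) < e" using CauchyD[OF assms(2) e] by blast
  have "v ((f i + g i) - (f j + g j)) < e" if "i \<ge> max M N" "j \<ge> max M N" for i j
  proof -
    have "v ((f i - f j) + (g i - g j)) \<le> max (v (f i - f j)) (v (g i - g j))" by (rule v_add_le)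
    also have "\<dots> < e" using that M N by simp
    finally show ?thesis by (simp add: algebra_simps)
  qed
  then show "\<exists>M. \<forall>i\<ge>M. \<forall>j\<ge>M. v (f i + g i - (f j + g j)) < e" by blast
qed

lemma Cauchy_minus: "padic_Cauchy p f \<Longrightarrow> padic_Cauchy p (\<lambda>i. - f i)"
  unfolding padic_Cauchy_def by (metis minus_diff_minus v_minus)

lemma Cauchy_v_convergent:
  assumes "padic_Cauchy p f"
  shows "convergent (\<lambda>i. v (f i))"
proof -
  have "Cauchy (\<lambda>i. v (f i))"
    unfolding Cauchy_def dist_real_def
    using CauchyD[OF assms] abs_v_diff_le by (metis order_le_less_trans)
  then show ?thesis by (rule Cauchy_convergent)
qed

lemma Cauchy_bounded:
  assumes "padic_Cauchy p f"
  obtains B where "B > 0" "\<And>i. v (f i) \<le> B"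
proof -
  obtain B where "\<And>i. norm (v (f i)) \<le> B" "B > 0"
    using convergent_imp_Bseq[OF Cauchy_v_convergent[OF assms]] by (metis BseqE)
  then show ?thesis using that by auto
qed

lemma Cauchy_mult:
  assumes "padic_Cauchy p f" and "padic_Cauchy p g"
  shows "padic_Cauchy p (\<lambda>i. f i * g i)"
  unfolding padic_Cauchy_def
proof (intro allI impI)
  fix e :: real assume e: "e > 0"
  obtain A where A: "A > 0" "\<And>i. v (f i) \<le> A" using Cauchy_bounded[OF assms(1)] by blast
  obtain B where B: "B > 0" "\<And>i. v (g i) \<le> B" using Cauchy_bounded[OF assms(2)] by blast
  obtain M where M: "\<forall>i\<ge>M. \<forall>j\<ge>M. v (f i - f j) < e / B"
    using CauchyD[OF assms(1)] e B by (meson divide_pos_pos)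
  obtain N where N: "\<forall>i\<ge>N. \<forall>j\<ge>N. v (g i - g j) < e / A"
    using CauchyD[OF assms(2)] e A by (meson divide_pos_pos)
  have "v (f i * g i - f j * g j) < e" if "i \<ge> max M N" "j \<ge> max M N" for i j
  proof -
    have "f i * g i - f j * g j = f i * (g i - g j) + (f i - f j) * g j" by (simp add: algebra_simps)
    then have "v (f i * g i - f j * g j) \<le> max (v (f i) * v (g i - g j)) (v (f i - f j) * v (g j))"
      by (metis v_add_le v_mult)
    moreover have "v (f i) * v (g i - g j) \<le> A * v (g i - g j)" by (intro mult_right_mono A) simp
    moreover have "A * v (g i - g j) < e" using N that A by (simp add: pos_less_divide_eq mult.commute)
    moreover have "v (f i - f j) * v (g j) \<le> v (f i - f j) * B" by (intro mult_left_mono B) simp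
    moreover have "v (f i - f j) * B < e" using M that B by (simp add: pos_less_divide_eq)
    ultimately show ?thesis by linarith
  qed
  then show "\<exists>M. \<forall>i\<ge>M. \<forall>j\<ge>M. v (f i * g i - f j * g j) < e" by blast
qed

lemma cring_C: "cring C"
proof (rule cringI)
  show "abelian_group C"
  proof (rule abelian_groupI)
    fix f assume "f \<in> carrier C"
    then show "\<exists>g\<in>carrier C. g \<oplus>\<^bsub>C\<^esub> f = \<zero>\<^bsub>C\<^esub>"
      by (intro bexI[of _ "\<lambda>i. - f i"]) (auto simp: C_simps Cauchy_minus)
  qed (auto simp: C_simps Cauchy_add Cauchy_const add_ac)
  show "comm_monoid C"
    by (rule comm_monoidI) (auto simp: C_simps Cauchy_mult Cauchy_const mult_ac)
qed (auto simp: C_simps algebra_simps)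

lemma null_iff: "f \<in> I \<longleftrightarrow> (\<lambda>i. v (f i)) \<longlonglongrightarrow> 0"
  by (simp add: padic_null_def)

lemma null_imp_Cauchy:
  assumes "f \<in> I"
  shows "padic_Cauchy p f"
  unfolding padic_Cauchy_def
proof (intro allI impI)
  fix e :: real assume e: "e > 0"
  from assms[unfolded null_iff, THEN LIMSEQ_D, OF e]
  obtain M where "\<forall>i\<ge>M. v (f i) < e" by auto
  then have "\<forall>i\<ge>M. \<forall>j\<ge>M. v (f i - f j) < e"
    by (metis max_less_iff_conj order_le_less_trans v_diff_le)
  then show "\<exists>M. \<forall>i\<ge>M. \<forall>j\<ge>M. v (f i - f j) < e" by blast
qed

lemma null_add:
  assumes "f \<in> I" and "g \<in> I"
  shows "(\<lambda>i. f i + g i) \<in> I"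
proof -
  have "(\<lambda>i. max (v (f i)) (v (g i))) \<longlonglongrightarrow> max 0 0"
    using assms by (intro tendsto_max) (auto simp: null_iff)
  then have "(\<lambda>i. max (v (f i)) (v (g i))) \<longlonglongrightarrow> 0" by simp
  then show ?thesis
    unfolding null_iff by (rule Lim_null_comparison[rotated]) (simp add: v_add_le)
qed

lemma null_mult:
  assumes "padic_Cauchy p f" and "g \<in> I"
  shows "(\<lambda>i. f i * g i) \<in> I"
proof -
  obtain L where "(\<lambda>i. v (f i)) \<longlonglongrightarrow> L" using Cauchy_v_convergent[OF assms(1)] by (auto simp: convergent_def)
  then have "(\<lambda>i. v (f i) * v (g i)) \<longlonglongrightarrow> L * 0"
    using assms(2) by (intro tendsto_mult) (auto simp: null_iff)
  then show ?thesis by (simp add: null_iff v_mult)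
qed

lemma C_uminus: "padic_Cauchy p f \<Longrightarrow> \<ominus>\<^bsub>C\<^esub> f = (\<lambda>i. - f i)"
proof -
  assume f: "padic_Cauchy p f"
  interpret C: cring C by (rule cring_C)
  show ?thesis
    by (rule C.minus_equality) (use f in \<open>auto simp: C_simps Cauchy_minus\<close>)
qed

lemma C_minus: "padic_Cauchy p f \<Longrightarrow> padic_Cauchy p g \<Longrightarrow> f \<ominus>\<^bsub>C\<^esub> g = (\<lambda>i. f i - g i)"
  by (simp add: a_minus_def C_uminus C_simps)

lemma null_ideal: "ideal I C"
proof -
  interpret C: cring C by (rule cring_C)
  show ?thesis
  proof (rule idealI)
    show "subgroup I (add_monoid C)"
    proof (rule C.add.subgroupI)
      show "I \<subseteq> carrier C" by (auto simp: C_simps null_imp_Cauchy)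
      show "I \<noteq> {}" using null_iff[of "\<lambda>_. 0"] by auto
      show "\<ominus>\<^bsub>C\<^esub> f \<in> I" if "f \<in> I" for f
        using that by (simp add: C_uminus null_imp_Cauchy null_iff)
      show "f \<oplus>\<^bsub>C\<^esub> g \<in> I" if "f \<in> I" "g \<in> I" for f g
        using that by (simp add: C_simps null_add)
    qed
    show "x \<otimes>\<^bsub>C\<^esub> a \<in> I" if "a \<in> I" "x \<in> carrier C" for a x
      using that by (simp add: C_simps null_mult)
    show "a \<otimes>\<^bsub>C\<^esub> x \<in> I" if "a \<in> I" "x \<in> carrier C" for a x
      using null_mult[of x a] that by (simp add: C_simps mult.commute)
  qed (rule C.ring_axioms)
qed

definition cls :: "(nat \<Rightarrow> rat) \<Rightarrow> (nat \<Rightarrow> rat) set" where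
  "cls f = I +>\<^bsub>C\<^esub> f"

abbreviation nrm :: "(nat \<Rightarrow> rat) set \<Rightarrow> real" where "nrm \<equiv> padic_abs p"

lemma cring_Q: "cring Q"
  unfolding padic_field_def by (rule ideal.quotient_is_cring[OF null_ideal cring_C])

lemma cls_hom: "ring_hom_cring C Q cls"
  using ideal.rcos_ring_hom_cring[OF null_ideal cring_C]
  unfolding padic_field_def cls_def[abs_def] .

sublocale C: cring C by (rule cring_C)
sublocale Q: cring Q by (rule cring_Q)
sublocale cls: ring_hom_cring C Q cls by (rule cls_hom)

lemma carrier_Q: "carrier Q = cls ` {f. padic_Cauchy p f}"
proof -
  have "carrier Q = (\<Union>f\<in>carrier C. {cls f})"
    by (simp only: padic_field_def FactRing_def A_RCOSETS_def' partial_object.select_convs cls_def)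
  then show ?thesis unfolding C_simps(1) by blast
qed

lemma cls_mem: "g \<in> cls f \<longleftrightarrow> (\<exists>h\<in>I. g = (\<lambda>i. h i + f i))"
  unfolding cls_def a_r_coset_def' C_simps(5) by blast

text \<open>
  The definition of \<^const>\<open>padic_abs\<close> as a unique limit is justified here: representatives of one
  coset differ by a null sequence, which does not change the limit of the absolute values.
\<close>
lemma nrm_cls_tendsto:
  assumes "padic_Cauchy p f"
  shows "(\<lambda>i. v (f i)) \<longlonglongrightarrow> nrm (cls f)"
proof -
  obtain L where L: "(\<lambda>i. v (f i)) \<longlonglongrightarrow> L" using Cauchy_v_convergent[OF assms] by (auto simp: convergent_def)
  have all: "\<forall>g\<in>cls f. (\<lambda>i. v (g i)) \<longlonglongrightarrow> L"
  proof
    fix g assume "g \<in> cls f"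
    then obtain h where h: "h \<in> I" "g = (\<lambda>i. h i + f i)" by (auto simp: cls_mem)
    have "(\<lambda>i. v (g i) - v (f i)) \<longlonglongrightarrow> 0"
    proof (rule Lim_null_comparison)
      show "(\<lambda>i. v (h i)) \<longlonglongrightarrow> 0" using h by (simp add: null_iff)
      show "\<forall>\<^sub>F i in sequentially. norm (v (g i) - v (f i)) \<le> v (h i)"
      proof (intro always_eventually allI)
        fix i
        show "norm (v (g i) - v (f i)) \<le> v (h i)"
          using abs_v_diff_le[of "g i" "f i"] by (simp add: h(2))
      qed
    qed
    from tendsto_add[OF this L] show "(\<lambda>i. v (g i)) \<longlonglongrightarrow> L" by simp
  qed
  have f: "f \<in> cls f" unfolding cls_mem by (rule bexI[of _ "\<lambda>_. 0"]) (auto simp: null_iff)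
  have "nrm (cls f) = L"
    unfolding padic_abs_def
  proof (rule the_equality)
    show "c = L" if "\<forall>g\<in>cls f. (\<lambda>i. v (g i)) \<longlonglongrightarrow> c" for c
      by (rule LIMSEQ_unique[OF bspec[OF that f] L])
  qed (rule all)
  with L show ?thesis by simp
qed

lemma carrier_QE:
  assumes "x \<in> carrier Q"
  obtains f where "padic_Cauchy p f" "x = cls f"
  using assms by (auto simp: carrier_Q)

lemma nrm_nonneg: "x \<in> carrier Q \<Longrightarrow> nrm x \<ge> 0"
proof -
  assume "x \<in> carrier Q"
  then obtain f where f: "padic_Cauchy p f" "x = cls f" by (rule carrier_QE)
  show ?thesis
    unfolding f(2) by (rule LIMSEQ_le_const[OF nrm_cls_tendsto[OF f(1)]]) simp
qed

lemma cls_minus: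
  assumes "padic_Cauchy p f" and "padic_Cauchy p g"
  shows "cls f \<ominus>\<^bsub>Q\<^esub> cls g = cls (\<lambda>i. f i - g i)"
proof -
  have "f \<in> carrier C" "g \<in> carrier C" using assms by (auto simp: C_simps)
  then have "cls (f \<ominus>\<^bsub>C\<^esub> g) = cls f \<ominus>\<^bsub>Q\<^esub> cls g" by (simp add: a_minus_def)
  then show ?thesis using assms by (simp add: C_minus)
qed

lemma nrm_eq_0_iff:
  assumes "x \<in> carrier Q"
  shows "nrm x = 0 \<longleftrightarrow> x = \<zero>\<^bsub>Q\<^esub>"
proof -
  obtain f where f: "padic_Cauchy p f" "x = cls f" using assms by (rule carrier_QE)
  have fC: "f \<in> carrier C" using f by (simp add: C_simps)
  have lim: "(\<lambda>i. v (f i)) \<longlonglongrightarrow> nrm x" unfolding f(2) by (rule nrm_cls_tendsto[OF f(1)])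
  have sub: "subgroup I (add_monoid C)"
    by (rule additive_subgroup.a_subgroup[OF ideal.axioms(1)[OF null_ideal]])
  have "nrm x = 0 \<longleftrightarrow> f \<in> I"
    using lim LIMSEQ_unique[OF lim] unfolding null_iff by metis
  also have "\<dots> \<longleftrightarrow> cls f = I"
  proof
    show "cls f = I \<Longrightarrow> f \<in> I"
      unfolding cls_def by (rule C.a_coset_join1[OF _ fC sub])
    show "f \<in> I \<Longrightarrow> cls f = I"
      unfolding cls_def by (rule C.a_coset_join2[OF fC sub])
  qed
  also have "I = \<zero>\<^bsub>Q\<^esub>" by (simp add: padic_field_def FactRing_def)
  finally show ?thesis using f by simp
qed

lemma nrm_mult:
  assumes "x \<in> carrier Q" and "y \<in> carrier Q"
  shows "nrm (x \<otimes>\<^bsub>Q\<^esub> y) = nrm x * nrm y"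
proof -
  obtain f where f: "padic_Cauchy p f" "x = cls f" using assms(1) by (rule carrier_QE)
  obtain g where g: "padic_Cauchy p g" "y = cls g" using assms(2) by (rule carrier_QE)
  have "x \<otimes>\<^bsub>Q\<^esub> y = cls (\<lambda>i. f i * g i)"
    using cls.hom_mult[of f g] f g by (simp add: C_simps)
  moreover have "(\<lambda>i. v (f i * g i)) \<longlonglongrightarrow> nrm (cls f) * nrm (cls g)"
    unfolding v_mult by (intro tendsto_mult nrm_cls_tendsto f g)
  ultimately show ?thesis
    using LIMSEQ_unique[OF nrm_cls_tendsto[OF Cauchy_mult[OF f(1) g(1)]]] f(2) g(2) by simp
qed

lemma nrm_add_le:
  assumes "x \<in> carrier Q" and "y \<in> carrier Q"
  shows "nrm (x \<oplus>\<^bsub>Q\<^esub> y) \<le> max (nrm x) (nrm y)"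
proof -
  obtain f where f: "padic_Cauchy p f" "x = cls f" using assms(1) by (rule carrier_QE)
  obtain g where g: "padic_Cauchy p g" "y = cls g" using assms(2) by (rule carrier_QE)
  have eq: "x \<oplus>\<^bsub>Q\<^esub> y = cls (\<lambda>i. f i + g i)"
    using cls.hom_add[of f g] f g by (simp add: C_simps)
  have "(\<lambda>i. max (v (f i)) (v (g i))) \<longlonglongrightarrow> max (nrm x) (nrm y)"
    unfolding f(2) g(2) by (intro tendsto_max nrm_cls_tendsto f g)
  from LIMSEQ_le[OF nrm_cls_tendsto[OF Cauchy_add[OF f(1) g(1)]] this]
  show ?thesis unfolding eq by (simp add: v_add_le)
qed

definition emb :: "rat \<Rightarrow> (nat \<Rightarrow> rat) set" where "emb q = cls (\<lambda>_. q)"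

lemma emb_closed [simp]: "emb q \<in> carrier Q"
  by (auto simp: emb_def carrier_Q Cauchy_const)

lemma emb_minus: "emb q \<ominus>\<^bsub>Q\<^esub> emb r = emb (q - r)"
  by (simp add: emb_def cls_minus Cauchy_const)

lemma emb_1: "emb 1 = \<one>\<^bsub>Q\<^esub>"
  using cls.hom_one by (simp add: emb_def C_simps)

lemma emb_mult: "emb q \<otimes>\<^bsub>Q\<^esub> emb r = emb (q * r)"
  using cls.hom_mult[of "\<lambda>_. q" "\<lambda>_. r"] by (simp add: emb_def C_simps Cauchy_const)

lemma emb_pow: "emb q [^]\<^bsub>Q\<^esub> (n::nat) = emb (q ^ n)"
  by (induction n) (simp_all add: emb_1 emb_mult mult.commute)

lemma nrm_emb [simp]: "nrm (emb q) = v q"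
  unfolding emb_def by (rule LIMSEQ_unique[OF nrm_cls_tendsto[OF Cauchy_const] tendsto_const])

text \<open>
  A bound on the tail suffices, since the absolute value of a class is a limit.
\<close>
lemma nrm_cls_diff_le:
  assumes "padic_Cauchy p f" and "\<And>i. i \<ge> M \<Longrightarrow> v (f i - q) \<le> e"
  shows "nrm (cls f \<ominus>\<^bsub>Q\<^esub> emb q) \<le> e"
proof -
  have c: "padic_Cauchy p (\<lambda>i. f i - q)"
    using Cauchy_add[OF assms(1) Cauchy_const[of "-q"]] by simp
  have "cls f \<ominus>\<^bsub>Q\<^esub> emb q = cls (\<lambda>i. f i - q)"
    unfolding emb_def by (rule cls_minus[OF assms(1) Cauchy_const])
  then show ?thesis
    using LIMSEQ_le_const2[OF nrm_cls_tendsto[OF c]] assms(2) by metis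
qed

section \<open>The ultrametric\<close>

abbreviation qd where "qd x y \<equiv> nrm (x \<ominus>\<^bsub>Q\<^esub> y)"

lemma nrm_one: "nrm \<one>\<^bsub>Q\<^esub> = 1"
  using nrm_emb[of 1] by (simp add: emb_1)

lemma emb_0: "emb 0 = \<zero>\<^bsub>Q\<^esub>"
  using nrm_eq_0_iff[of "emb 0"] by simp

lemma nrm_uminus:
  assumes "x \<in> carrier Q"
  shows "nrm (\<ominus>\<^bsub>Q\<^esub> x) = nrm x"
proof -
  have "\<zero>\<^bsub>Q\<^esub> \<ominus>\<^bsub>Q\<^esub> \<one>\<^bsub>Q\<^esub> = emb (-1)"
    using emb_minus[of 0 1] by (simp add: emb_0 emb_1)
  then have "\<ominus>\<^bsub>Q\<^esub> \<one>\<^bsub>Q\<^esub> = emb (-1)" by (simp add: a_minus_def)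
  then have "\<ominus>\<^bsub>Q\<^esub> x = emb (-1) \<otimes>\<^bsub>Q\<^esub> x" using assms Q.l_minus[of "\<one>\<^bsub>Q\<^esub>" x] by simp
  then show ?thesis using assms by (simp add: nrm_mult)
qed

lemma qd_commute:
  assumes "x \<in> carrier Q" and "y \<in> carrier Q"
  shows "qd x y = qd y x"
  using nrm_uminus[of "y \<ominus>\<^bsub>Q\<^esub> x"] assms by (simp add: Q.minus_add a_minus_def Q.add.m_comm)

lemma qd_triangle:
  assumes "x \<in> carrier Q" and "y \<in> carrier Q" and "z \<in> carrier Q"
  shows "qd x z \<le> max (qd x y) (qd y z)"
proof -
  have "x \<ominus>\<^bsub>Q\<^esub> z = (x \<ominus>\<^bsub>Q\<^esub> y) \<oplus>\<^bsub>Q\<^esub> (y \<ominus>\<^bsub>Q\<^esub> z)"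
    using assms by (simp add: a_minus_def Q.a_assoc Q.r_neg1)
  then show ?thesis using nrm_add_le assms by simp
qed

lemma qd_eq_0_iff:
  assumes "x \<in> carrier Q" and "y \<in> carrier Q"
  shows "qd x y = 0 \<longleftrightarrow> x = y"
  using assms by (simp add: nrm_eq_0_iff Q.r_right_minus_eq)

text \<open>
  In an ultrametric triangle the two longest sides are equal.
\<close>
lemma qd_eq_of_less:
  assumes "x \<in> carrier Q" and "y \<in> carrier Q" and "a \<in> carrier Q" and "qd x y < qd x a"
  shows "qd y a = qd x a"
proof -
  have "qd x a \<le> max (qd x y) (qd y a)" "qd y a \<le> max (qd y x) (qd x a)"
    using qd_triangle assms by blast+
  then show ?thesis using assms(4) qd_commute[OF assms(1,2)] by linarith
qed

lemma Metric_space_padic: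
  assumes "S \<subseteq> carrier Q"
  shows "Metric_space S (padic_dist p)"
proof
  show "0 \<le> padic_dist p x y" for x y by (simp add: padic_dist_def nrm_nonneg)
  show "padic_dist p x y = padic_dist p y x" for x y by (simp add: padic_dist_def qd_commute)
  show "padic_dist p x y = 0 \<longleftrightarrow> x = y" if "x \<in> S" "y \<in> S" for x y
    using that assms by (auto simp: padic_dist_def qd_eq_0_iff)
  show "padic_dist p x z \<le> padic_dist p x y + padic_dist p y z" if "x \<in> S" "y \<in> S" "z \<in> S" for x y z
  proof -
    have "x \<in> carrier Q" "y \<in> carrier Q" "z \<in> carrier Q" using that assms by auto
    then show ?thesis
      using qd_triangle[of x y z] nrm_nonneg[of "x \<ominus>\<^bsub>Q\<^esub> y"] nrm_nonneg[of "y \<ominus>\<^bsub>Q\<^esub> z"]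
      unfolding padic_dist_def by simp
  qed
qed

lemma rat_dense:
  assumes "padic_Cauchy p f" and "e > 0"
  shows "\<exists>M. \<forall>j\<ge>M. qd (cls f) (emb (f j)) \<le> e"
proof -
  obtain M where "\<forall>i\<ge>M. \<forall>j\<ge>M. v (f i - f j) < e" using CauchyD[OF assms] by blast
  then have "\<forall>j\<ge>M. qd (cls f) (emb (f j)) \<le> e"
    by (metis less_eq_real_def nrm_cls_diff_le[OF assms(1)])
  then show ?thesis by blast
qed

text \<open>
  A rational number close to \<open>x\<close> has absolute value at most \<open>1\<close> by the ultrametric inequality,
  so it is in turn close to an integer.
\<close>
lemma int_dense:
  assumes "x \<in> carrier Q" and "nrm x \<le> 1"
  shows "\<exists>a::int. qd x (emb (of_int a)) \<le> real p powi (- int k)"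
proof -
  let ?e = "real p powi (- int k)"
  have e: "?e > 0" "?e \<le> 1" using p_gt_1 by (simp_all add: power_int_minus inverse_le_1_iff)
  obtain f where f: "padic_Cauchy p f" "x = cls f" using assms(1) by (rule carrier_QE)
  obtain q where q: "qd x (emb q) \<le> ?e" using rat_dense[OF f(1) e(1)] f(2) by blast
  have "nrm (emb q) = qd (emb q) \<zero>\<^bsub>Q\<^esub>" by (simp add: a_minus_def)
  also have "\<dots> \<le> max (qd (emb q) x) (qd x \<zero>\<^bsub>Q\<^esub>)" by (rule qd_triangle) (use assms in auto)
  also have "qd x \<zero>\<^bsub>Q\<^esub> = nrm x" using assms by (simp add: a_minus_def)
  also have "max (qd (emb q) x) (nrm x) \<le> 1" using q e assms by (simp add: qd_commute)
  finally have "v q \<le> 1" by simp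
  then obtain a :: int where a: "v (q - of_int a) \<le> ?e" using v_le_1_int_approx by blast
  have "qd x (emb (of_int a)) \<le> max (qd x (emb q)) (qd (emb q) (emb (of_int a)))"
    by (rule qd_triangle) (use assms in auto)
  also have "\<dots> \<le> ?e" using q a by (simp add: emb_minus)
  finally show ?thesis by blast
qed

text \<open>
  Powers do not increase distances in the unit ball, by
  \<open>x\<^sup>m x - y\<^sup>m y = (x\<^sup>m - y\<^sup>m) x + y\<^sup>m (x - y)\<close>.
\<close>
lemma qd_pow_le:
  assumes "x \<in> carrier Q" and "y \<in> carrier Q" and "nrm x \<le> 1" and "nrm y \<le> 1"
  shows "qd (x [^]\<^bsub>Q\<^esub> (m::nat)) (y [^]\<^bsub>Q\<^esub> m) \<le> qd x y"
proof (induction m)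
  case 0
  have "qd \<one>\<^bsub>Q\<^esub> \<one>\<^bsub>Q\<^esub> = 0" by (simp add: qd_eq_0_iff)
  then show ?case using assms nrm_nonneg by simp
next
  case (Suc m)
  let ?X = "x [^]\<^bsub>Q\<^esub> m" and ?Y = "y [^]\<^bsub>Q\<^esub> m"
  have pw: "nrm ?Y \<le> 1"
  proof (induction m)
    case (Suc m)
    then show ?case using assms by (simp add: nrm_mult nrm_nonneg mult_le_one)
  qed (simp add: nrm_one)
  have c: "?X \<in> carrier Q" "?Y \<in> carrier Q" using assms by simp_all
  have "?X \<otimes>\<^bsub>Q\<^esub> x \<ominus>\<^bsub>Q\<^esub> ?Y \<otimes>\<^bsub>Q\<^esub> y = (?X \<ominus>\<^bsub>Q\<^esub> ?Y) \<otimes>\<^bsub>Q\<^esub> x \<oplus>\<^bsub>Q\<^esub> ?Y \<otimes>\<^bsub>Q\<^esub> (x \<ominus>\<^bsub>Q\<^esub> y)"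
    using assms(1,2) c by algebra
  then have "qd (x [^]\<^bsub>Q\<^esub> Suc m) (y [^]\<^bsub>Q\<^esub> Suc m) \<le> max (qd ?X ?Y * nrm x) (nrm ?Y * qd x y)"
    using nrm_add_le[of "(?X \<ominus>\<^bsub>Q\<^esub> ?Y) \<otimes>\<^bsub>Q\<^esub> x" "?Y \<otimes>\<^bsub>Q\<^esub> (x \<ominus>\<^bsub>Q\<^esub> y)"] assms c
    by (simp add: nrm_mult)
  moreover have "qd ?X ?Y * nrm x \<le> qd ?X ?Y * 1"
    by (rule mult_left_mono) (use assms c nrm_nonneg in auto)
  moreover have "nrm ?Y * qd x y \<le> 1 * qd x y"
    by (rule mult_right_mono) (use pw assms c nrm_nonneg in auto)
  ultimately show ?case using Suc by linarith
qed

lemma qd_emb_int_le_iff: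
  "qd (emb (of_int a)) (emb (of_int b)) \<le> real p powi (- int k) \<longleftrightarrow> [a = b] (mod int p ^ k)"
  using v_int_le_iff[of "a - b" k] by (simp add: emb_minus cong_iff_dvd_diff)

end

section \<open>The sphere around 1\<close>

locale padic_unit_sphere = padic +
  fixes l :: nat
  assumes l: "l \<ge> 1"
begin

definition S where "S = padic_sphere p (real p powi (- int l)) \<one>\<^bsub>Q\<^esub>"

lemma S_iff: "x \<in> S \<longleftrightarrow> x \<in> carrier Q \<and> qd x \<one>\<^bsub>Q\<^esub> = real p powi (- int l)"
  by (simp add: S_def padic_sphere_def)

lemma S_carrier: "x \<in> S \<Longrightarrow> x \<in> carrier Q"
  by (simp add: S_iff)

lemma powi_mono: "j \<le> k \<Longrightarrow> real p powi (- int k) \<le> real p powi (- int j)"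
  using p_gt_1 by (intro power_int_increasing) auto

lemma powi_strict: "j < k \<Longrightarrow> real p powi (- int k) < real p powi (- int j)"
  using p_gt_1 by (intro power_int_strict_increasing) auto

lemma S_nrm:
  assumes "x \<in> S"
  shows "nrm x \<le> 1"
proof -
  have x: "x \<in> carrier Q" using assms by (rule S_carrier)
  have "nrm x = qd x \<zero>\<^bsub>Q\<^esub>" using x by (simp add: a_minus_def)
  also have "\<dots> \<le> max (qd x \<one>\<^bsub>Q\<^esub>) (qd \<one>\<^bsub>Q\<^esub> \<zero>\<^bsub>Q\<^esub>)" by (rule qd_triangle) (use x in auto)
  also have "qd \<one>\<^bsub>Q\<^esub> \<zero>\<^bsub>Q\<^esub> = 1" by (simp add: a_minus_def nrm_one)
  also have "max (qd x \<one>\<^bsub>Q\<^esub>) 1 \<le> 1"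
    using assms powi_mono[of 0 l] by (simp add: S_iff)
  finally show ?thesis .
qed

text \<open>
  The sphere is open: a displacement smaller than its radius does not change the distance to the
  centre.
\<close>
lemma S_near:
  assumes "x \<in> S" and "y \<in> carrier Q" and "qd x y \<le> real p powi (- int (Suc l))"
  shows "y \<in> S"
proof -
  have "qd x y < qd x \<one>\<^bsub>Q\<^esub>" using assms powi_strict[of l "Suc l"] by (simp add: S_iff)
  then have "qd y \<one>\<^bsub>Q\<^esub> = qd x \<one>\<^bsub>Q\<^esub>"
    using assms by (intro qd_eq_of_less) (auto simp: S_iff)
  with assms show ?thesis by (simp add: S_iff)
qed

lemma emb_int_in_S_iff: "emb (of_int a) \<in> S \<longleftrightarrow> exact_power_dvd (int p) l (a - 1)"
proof -
  have q: "qd (emb (of_int a)) \<one>\<^bsub>Q\<^esub> = v (of_int (a - 1))"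
    using emb_minus[of "of_int a" 1] by (simp add: emb_1)
  have "v (of_int (a - 1)) = real p powi (- int l) \<longleftrightarrow> exact_power_dvd (int p) l (a - 1)"
  proof (cases "a - 1 = 0")
    case True
    then show ?thesis using p_gt_1 by (simp add: exact_power_dvd_def)
  next
    case False
    let ?m = "multiplicity (int p) (a - 1)"
    have nu: "\<not> is_unit (int p)" using p_gt_1 by simp
    have "v (of_int (a - 1)) = real p powi (- int l) \<longleftrightarrow> ?m = l"
      unfolding v_int[OF False]
      using powi_strict[of l ?m] powi_strict[of ?m l] by (cases ?m l rule: linorder_cases) auto
    also have "\<dots> \<longleftrightarrow> l \<le> ?m \<and> \<not> Suc l \<le> ?m" by auto
    also have "\<dots> \<longleftrightarrow> exact_power_dvd (int p) l (a - 1)"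
      unfolding exact_power_dvd_def using power_dvd_iff_le_multiplicity[OF False nu] by blast
    finally show ?thesis .
  qed
  then show ?thesis by (simp only: S_iff q emb_closed simp_thms)
qed

lemma S_approx:
  assumes "x \<in> S" and "k > l"
  obtains a :: int where "qd x (emb (of_int a)) \<le> real p powi (- int k)"
    "emb (of_int a) \<in> S" "exact_power_dvd (int p) l (a - 1)"
proof -
  obtain a :: int where a: "qd x (emb (of_int a)) \<le> real p powi (- int k)"
    using int_dense[OF S_carrier[OF assms(1)] S_nrm[OF assms(1)]] by blast
  also have "\<dots> \<le> real p powi (- int (Suc l))" using assms(2) by (intro powi_mono) simp
  finally have "emb (of_int a) \<in> S" by (rule S_near[OF assms(1) emb_closed])
  with a that show ?thesis by (simp add: emb_int_in_S_iff)
qed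

sublocale M: Metric_space S "padic_dist p"
  by (rule Metric_space_padic) (auto simp: S_iff)

lemma dist_S: "x \<in> S \<Longrightarrow> y \<in> S \<Longrightarrow> padic_dist p x y = qd x y"
  by (simp add: padic_dist_def S_carrier)

lemma ex_powi_less:
  assumes "e > 0"
  shows "\<exists>k>j. real p powi (- int k) < e"
proof -
  obtain k where k: "(1 / real p) ^ k < e"
    using real_arch_pow_inv[OF assms, of "1 / real p"] p_gt_1 by auto
  have "real p powi (- int (max k (Suc j))) \<le> real p powi (- int k)" by (rule powi_mono) simp
  also have "\<dots> < e" using k by (simp add: power_int_minus power_one_over inverse_eq_divide)
  finally show ?thesis by (intro exI[of _ "max k (Suc j)"]) simp
qed

text \<open>
  Replacing the terms of a Cauchy sequence by integers that are ever closer to them gives a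
  rational Cauchy sequence, whose class is the limit. It lies on the sphere because the distance
  to the sequence eventually falls below the radius.
\<close>
lemma S_mcomplete: "M.mcomplete"
  unfolding M.mcomplete_def
proof (intro allI impI)
  fix x :: "nat \<Rightarrow> (nat \<Rightarrow> rat) set"
  assume cau: "M.MCauchy x"
  then have xS: "x i \<in> S" for i by (auto simp: M.MCauchy_def)
  have "\<exists>a::int. qd (x j) (emb (of_int a)) \<le> real p powi (- int j)" for j
    using int_dense[OF S_carrier[OF xS] S_nrm[OF xS]] by blast
  then obtain a :: "nat \<Rightarrow> int" where a: "\<And>j. qd (x j) (emb (of_int (a j))) \<le> real p powi (- int j)"
    by metis
  define f :: "nat \<Rightarrow> rat" where "f = (\<lambda>j. of_int (a j))"
  have xC: "x i \<in> carrier Q" for i using xS by (rule S_carrier)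
  have xf: "qd (x j) (emb (f j)) \<le> real p powi (- int k)" if "j \<ge> k" for j k
    using a[of j] powi_mono[OF that] by (simp add: f_def)
  have fC: "padic_Cauchy p f"
    unfolding padic_Cauchy_def
  proof (intro allI impI)
    fix e :: real assume e: "e > 0"
    obtain k where k: "real p powi (- int k) < e" using ex_powi_less[OF e] by blast
    obtain N where N: "\<And>i j. N \<le> i \<Longrightarrow> N \<le> j \<Longrightarrow> padic_dist p (x i) (x j) < e"
      using cau e unfolding M.MCauchy_def by blast
    have "v (f i - f j) < e" if "i \<ge> max N k" "j \<ge> max N k" for i j
    proof -
      have "v (f i - f j) = qd (emb (f i)) (emb (f j))" by (simp add: emb_minus)
      also have "\<dots> \<le> max (qd (emb (f i)) (x i)) (qd (x i) (emb (f j)))"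
        by (rule qd_triangle) (auto simp: xC)
      also have "\<dots> \<le> max (qd (emb (f i)) (x i)) (max (qd (x i) (x j)) (qd (x j) (emb (f j))))"
        using qd_triangle[of "x i" "x j" "emb (f j)"] by (auto simp: xC)
      also have "\<dots> < e"
        using N[of i j] xf[of k i] xf[of k j] k that by (simp add: qd_commute xC dist_S xS)
      finally show ?thesis .
    qed
    then show "\<exists>M. \<forall>i\<ge>M. \<forall>j\<ge>M. v (f i - f j) < e" by blast
  qed
  define y where "y = cls f"
  have yC: "y \<in> carrier Q" using fC by (auto simp: y_def carrier_Q)
  have near: "\<exists>N. \<forall>j\<ge>N. qd (x j) y \<le> e" if e: "e > 0" for e
  proof -
    obtain k where k: "real p powi (- int k) < e" using ex_powi_less[OF e] by blast
    obtain N where N: "\<forall>j\<ge>N. qd y (emb (f j)) \<le> e" using rat_dense[OF fC e] y_def by blast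
    have "qd (x j) y \<le> e" if "j \<ge> max N k" for j
    proof -
      have "qd (x j) y \<le> max (qd (x j) (emb (f j))) (qd (emb (f j)) y)"
        by (rule qd_triangle) (auto simp: xC yC)
      also have "\<dots> \<le> e" using N xf[of k j] k that by (simp add: qd_commute yC)
      finally show ?thesis .
    qed
    then show ?thesis by blast
  qed
  obtain j where "qd (x j) y \<le> real p powi (- int (Suc l))"
    using near[of "real p powi (- int (Suc l))"] p_gt_1 by (auto simp del: of_nat_Suc)
  then have yS: "y \<in> S" using S_near[OF xS yC] by blast
  have "limitin M.mtopology x y sequentially"
    unfolding M.limit_metric_sequentially
  proof (intro conjI allI impI yS)
    fix e :: real assume "e > 0"
    then obtain N where "\<forall>j\<ge>N. qd (x j) y \<le> e / 2" using near[of "e / 2"] by auto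
    then show "\<exists>N. \<forall>n\<ge>N. x n \<in> S \<and> padic_dist p (x n) y < e"
      using \<open>e > 0\<close> by (intro exI[of _ N]) (auto simp: dist_S xS yS field_simps intro: order_le_less_trans)
  qed
  then show "\<exists>y. limitin M.mtopology x y sequentially" by blast
qed

text \<open>
  Up to precision \<open>p ^ (- k)\<close> every point of the sphere is a residue class of integers
  modulo \<open>p ^ k\<close>, and there are finitely many of these.
\<close>
lemma S_mtotally_bounded: "M.mtotally_bounded S"
  unfolding M.mtotally_bounded_def
proof (intro allI impI)
  fix e :: real assume "e > 0"
  then obtain k where k: "k > l" "real p powi (- int k) < e" using ex_powi_less by blast
  define K where "K = (\<lambda>a::int. emb (of_int a)) ` {0..<int p ^ k} \<inter> S"
  have "S \<subseteq> (\<Union>c\<in>K. M.mball c e)"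
  proof
    fix x assume x: "x \<in> S"
    obtain a :: int where a: "qd x (emb (of_int a)) \<le> real p powi (- int k)"
      using S_approx[OF x k(1)] by metis
    let ?b = "a mod int p ^ k"
    have "qd (emb (of_int a)) (emb (of_int ?b)) \<le> real p powi (- int k)"
      by (simp add: qd_emb_int_le_iff)
    then have b: "qd x (emb (of_int ?b)) \<le> real p powi (- int k)"
      using a qd_triangle[of x "emb (of_int a)" "emb (of_int ?b)"] S_carrier[OF x] by simp
    also have "\<dots> \<le> real p powi (- int (Suc l))" using k by (intro powi_mono) simp
    finally have bS: "emb (of_int ?b) \<in> S" by (rule S_near[OF x emb_closed])
    have "?b \<in> {0..<int p ^ k}" using p_gt_1 by simp
    then have "emb (of_int ?b) \<in> K" using bS by (auto simp: K_def)
    moreover have "x \<in> M.mball (emb (of_int ?b)) e"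
      using x bS b k(2) by (simp add: dist_S qd_commute S_carrier)
    ultimately show "x \<in> (\<Union>c\<in>K. M.mball c e)" by blast
  qed
  moreover have "finite K" "K \<subseteq> S" by (auto simp: K_def)
  ultimately show "\<exists>K. finite K \<and> K \<subseteq> S \<and> S \<subseteq> (\<Union>c\<in>K. M.mball c e)" by blast
qed

lemma S_compact: "compact_space M.mtopology"
  by (simp add: M.compact_space_eq_mcomplete_mtotally_bounded S_mcomplete S_mtotally_bounded)

text \<open>
  For an integer near \<open>x\<close> this is the invariance of the valuation of \<open>a - 1\<close> under powers prime to \<open>p\<close>; the general case follows
  because taking powers does not increase distances.
\<close>
lemma pow_in_S:
  assumes "x \<in> S" and "\<not> p dvd m"
  shows "x [^]\<^bsub>Q\<^esub> m \<in> S"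
proof -
  obtain a :: int where a: "qd x (emb (of_int a)) \<le> real p powi (- int (Suc l))"
    "emb (of_int a) \<in> S" "exact_power_dvd (int p) l (a - 1)"
    using S_approx[OF assms(1), of "Suc l"] by blast
  have "emb (of_int (a ^ m)) \<in> S"
    using exact_power_dvd_power_coprime[OF p l a(3) assms(2)] by (simp only: emb_int_in_S_iff)
  moreover have "qd (emb (of_int (a ^ m))) (x [^]\<^bsub>Q\<^esub> m) \<le> real p powi (- int (Suc l))"
    using qd_pow_le[of "emb (of_int a)" x m] a assms(1) S_nrm S_carrier qd_commute
    by (simp add: emb_pow v_int_le_1)
  ultimately show ?thesis using S_near S_carrier[OF assms(1)] by blast
qed

lemma pow_continuous:
  assumes "\<not> p dvd m"
  shows "continuous_map M.mtopology M.mtopology (\<lambda>x. x [^]\<^bsub>Q\<^esub> m)"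
  unfolding M.metric_continuous_map[OF M.Metric_space_axioms]
proof (intro conjI ballI allI impI)
  show "(\<lambda>x. x [^]\<^bsub>Q\<^esub> m) ` S \<subseteq> S" using pow_in_S[OF _ assms] by blast
  fix a and e :: real assume aS: "a \<in> S" and e: "e > 0"
  have "padic_dist p (a [^]\<^bsub>Q\<^esub> m) (x [^]\<^bsub>Q\<^esub> m) < e" if "x \<in> S" "padic_dist p a x < e" for x
    using that qd_pow_le[of a x m] aS by (simp add: dist_S pow_in_S[OF _ assms] S_carrier S_nrm)
  with e show "\<exists>d>0. \<forall>x. x \<in> S \<and> padic_dist p a x < d \<longrightarrow> padic_dist p (a [^]\<^bsub>Q\<^esub> m) (x [^]\<^bsub>Q\<^esub> m) < e"
    by blast
qed

lemma funpow_pow: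
  assumes "x \<in> carrier Q"
  shows "((\<lambda>x. x [^]\<^bsub>Q\<^esub> (n::nat)) ^^ N) x = x [^]\<^bsub>Q\<^esub> (n ^ N)"
  by (induction N) (use assms in \<open>simp_all add: Q.nat_pow_pow mult.commute\<close>)

lemma orbit_dense_iff:
  assumes "\<not> p dvd n" and x: "x \<in> S"
  shows "M.mtopology closure_of {((\<lambda>x. x [^]\<^bsub>Q\<^esub> n) ^^ N) x | N. True} = S \<longleftrightarrow>
    (\<forall>y\<in>S. \<forall>k. \<exists>N. qd y (x [^]\<^bsub>Q\<^esub> (n ^ N)) \<le> real p powi (- int k))"
proof -
  have nN: "\<not> p dvd n ^ N" for N using assms(1) p prime_dvd_power by blast
  have ball: "x [^]\<^bsub>Q\<^esub> (n ^ N) \<in> M.mball y r \<longleftrightarrow> qd y (x [^]\<^bsub>Q\<^esub> (n ^ N)) < r"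
    if "y \<in> S" for y N r
    using pow_in_S[OF x nN] that by (simp add: dist_S)
  have "M.mtopology closure_of {((\<lambda>x. x [^]\<^bsub>Q\<^esub> n) ^^ N) x | N. True} =
      {y \<in> S. \<forall>r>0. \<exists>N. x [^]\<^bsub>Q\<^esub> (n ^ N) \<in> M.mball y r}"
    unfolding M.metric_closure_of funpow_pow[OF S_carrier[OF x]] by blast
  also have "\<dots> = {y \<in> S. \<forall>r>0. \<exists>N. qd y (x [^]\<^bsub>Q\<^esub> (n ^ N)) < r}"
    using ball by (intro Collect_cong conj_cong refl) simp
  also have "\<dots> = S \<longleftrightarrow> (\<forall>y\<in>S. \<forall>r>0. \<exists>N. qd y (x [^]\<^bsub>Q\<^esub> (n ^ N)) < r)" by blast
  also have "\<dots> \<longleftrightarrow> (\<forall>y\<in>S. \<forall>k. \<exists>N. qd y (x [^]\<^bsub>Q\<^esub> (n ^ N)) \<le> real p powi (- int k))"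
  proof (intro ball_cong refl iffI allI impI)
    fix y k assume "\<forall>r>0. \<exists>N. qd y (x [^]\<^bsub>Q\<^esub> (n ^ N)) < r"
    moreover have "real p powi (- int k) > 0" using p_gt_1 by simp
    ultimately show "\<exists>N. qd y (x [^]\<^bsub>Q\<^esub> (n ^ N)) \<le> real p powi (- int k)"
      using less_imp_le by blast
  next
    fix y and r :: real
    assume *: "\<forall>k. \<exists>N. qd y (x [^]\<^bsub>Q\<^esub> (n ^ N)) \<le> real p powi (- int k)" and "r > 0"
    then obtain k where "real p powi (- int k) < r" using ex_powi_less by blast
    moreover obtain N where "qd y (x [^]\<^bsub>Q\<^esub> (n ^ N)) \<le> real p powi (- int k)" using * by blast
    ultimately show "\<exists>N. qd y (x [^]\<^bsub>Q\<^esub> (n ^ N)) < r" by (meson order_le_less_trans)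
  qed
  finally show ?thesis .
qed

lemma minimal_map_iff:
  assumes "\<not> p dvd n"
  shows "minimal_map S (padic_dist p) (\<lambda>x. x [^]\<^bsub>Q\<^esub> n) \<longleftrightarrow>
    (\<forall>x\<in>S. \<forall>y\<in>S. \<forall>k. \<exists>N. qd y (x [^]\<^bsub>Q\<^esub> (n ^ N)) \<le> real p powi (- int k))"
  unfolding minimal_map_def
  using M.Metric_space_axioms S_compact pow_continuous[OF assms] orbit_dense_iff[OF assms] by simp

text \<open>
  Integers approximate the points of the sphere arbitrarily well, and \<open>x \<mapsto> x\<^sup>N\<close> does not increase
  distances for any \<open>N\<close>, so density of all orbits can be tested on integers, where it is a
  statement about congruences.
\<close>
lemma minimal_map_iff_int:
  assumes "\<not> p dvd n"
  shows "minimal_map S (padic_dist p) (\<lambda>x. x [^]\<^bsub>Q\<^esub> n) \<longleftrightarrow>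
    (\<forall>a b k. exact_power_dvd (int p) l (a - 1) \<longrightarrow> exact_power_dvd (int p) l (b - 1) \<longrightarrow>
       (\<exists>N. [a ^ (n ^ N) = b] (mod int p ^ k)))"
  unfolding minimal_map_iff[OF assms]
proof (intro iffI allI impI ballI)
  fix a b k
  assume *: "\<forall>x\<in>S. \<forall>y\<in>S. \<forall>k. \<exists>N. qd y (x [^]\<^bsub>Q\<^esub> (n ^ N)) \<le> real p powi (- int k)"
    and "exact_power_dvd (int p) l (a - 1)" "exact_power_dvd (int p) l (b - 1)"
  then obtain N where "qd (emb (of_int b)) (emb (of_int a) [^]\<^bsub>Q\<^esub> (n ^ N)) \<le> real p powi (- int k)"
    unfolding emb_int_in_S_iff[symmetric] by blast
  then have "[b = a ^ (n ^ N)] (mod int p ^ k)"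
    unfolding emb_pow of_int_power[symmetric] qd_emb_int_le_iff .
  then show "\<exists>N. [a ^ (n ^ N) = b] (mod int p ^ k)" using cong_sym by blast
next
  fix x y k
  assume *: "\<forall>a b k. exact_power_dvd (int p) l (a - 1) \<longrightarrow> exact_power_dvd (int p) l (b - 1) \<longrightarrow>
       (\<exists>N. [a ^ (n ^ N) = b] (mod int p ^ k))" and x: "x \<in> S" and y: "y \<in> S"
  define k' where "k' = max k (Suc l)"
  have k': "k' > l" "k \<le> k'" by (auto simp: k'_def)
  obtain a :: int where a: "qd x (emb (of_int a)) \<le> real p powi (- int k')"
    "emb (of_int a) \<in> S" "exact_power_dvd (int p) l (a - 1)"
    using S_approx[OF x k'(1)] by blast
  obtain b :: int where b: "qd y (emb (of_int b)) \<le> real p powi (- int k')"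
    "emb (of_int b) \<in> S" "exact_power_dvd (int p) l (b - 1)"
    using S_approx[OF y k'(1)] by blast
  obtain N where "[a ^ (n ^ N) = b] (mod int p ^ k')" using * a(3) b(3) by blast
  then have ba: "qd (emb (of_int b)) (emb (of_int a) [^]\<^bsub>Q\<^esub> (n ^ N)) \<le> real p powi (- int k')"
    unfolding emb_pow of_int_power[symmetric] qd_emb_int_le_iff by (rule cong_sym)
  have ax: "qd (emb (of_int a) [^]\<^bsub>Q\<^esub> (n ^ N)) (x [^]\<^bsub>Q\<^esub> (n ^ N)) \<le> real p powi (- int k')"
    using qd_pow_le[of "emb (of_int a)" x "n ^ N"] a x S_nrm S_carrier qd_commute v_int_le_1 by simp
  have c: "x \<in> carrier Q" "y \<in> carrier Q" using x y S_carrier by auto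
  have "qd y (x [^]\<^bsub>Q\<^esub> (n ^ N)) \<le> real p powi (- int k')"
    using qd_triangle[of y "emb (of_int b)" "x [^]\<^bsub>Q\<^esub> (n ^ N)"]
      qd_triangle[of "emb (of_int b)" "emb (of_int a) [^]\<^bsub>Q\<^esub> (n ^ N)" "x [^]\<^bsub>Q\<^esub> (n ^ N)"]
      b(1) ba ax c by simp
  also have "\<dots> \<le> real p powi (- int k)" by (rule powi_mono[OF k'(2)])
  finally show "\<exists>N. qd y (x [^]\<^bsub>Q\<^esub> (n ^ N)) \<le> real p powi (- int k)" by blast
qed

end

section \<open>Minimality and generators\<close>

theorem theorem3p2:
  fixes p l n :: nat
  assumes "prime p" and "p \<noteq> 2" and "l \<ge> 1" and "gcd n p = 1"
  shows "minimal_map (padic_sphere p (real p powi (- int l)) \<one>\<^bsub>padic_field p\<^esub>) (padic_dist p)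
           (\<lambda>x. x [^]\<^bsub>padic_field p\<^esub> n)
         \<longleftrightarrow> generates_units_mod (p ^ 2) n"
proof -
  interpret padic_unit_sphere p l by unfold_locales (use assms in auto)
  have cop: "coprime n p" using assms(4) by (simp add: coprime_iff_gcd_eq_1)
  have ndvd: "\<not> p dvd n"
    using assms(1) cop by (metis coprime_absorb_left not_prime_unit coprime_commute)
  have "generates_units_mod (p ^ 2) n"
    if min: "\<forall>a b k. exact_power_dvd (int p) l (a - 1) \<longrightarrow> exact_power_dvd (int p) l (b - 1) \<longrightarrow>
       (\<exists>N. [a ^ (n ^ N) = b] (mod int p ^ k))"
    unfolding generates_units_mod_iff[OF assms(1) cop]
  proof (intro allI impI)
    fix c assume c: "coprime c (int p)"
    define m where "m = nat (c mod int p ^ 2)"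
    have m: "[int m = c] (mod int p ^ 2)"
      using assms(1) by (simp add: m_def cong_def prime_gt_0_nat)
    have "[c = int m] (mod int p)"
      by (rule cong_dvd_modulus[OF cong_sym[OF m]]) (simp add: power2_eq_square)
    then have "coprime (int m) (int p)" using c by (rule cong_imp_coprime)
    then have nm: "\<not> p dvd m"
      using assms(1) by (metis coprime_absorb_left coprime_commute coprime_int_iff not_prime_unit)
    \<comment> \<open>The orbit of \<open>a\<close> comes close to \<open>a ^ m\<close>; precision \<open>l + 2\<close> compares the exponents
      \<open>n ^ N\<close> and \<open>m\<close> modulo \<open>p\<^sup>2\<close>.\<close>
    define a where "a = 1 + int p ^ l"
    have a: "exact_power_dvd (int p) l (a - 1)"
      using p_gt_1 by (auto simp: exact_power_dvd_def a_def zdvd_not_zless)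
    obtain N where "[a ^ (n ^ N) = a ^ m] (mod int p ^ (l + 2))"
      using min a exact_power_dvd_power_coprime[OF assms(1,3) a nm] by blast
    then have "[n ^ N = m] (mod p ^ 2)"
      using cong_power_iff_cong_exponent[OF assms(1-3) a] by blast
    then have "[int n ^ N = int m] (mod int p ^ 2)" by (metis cong_int_iff of_nat_power)
    then show "\<exists>N. [int n ^ N = c] (mod int p ^ 2)" using m cong_trans by blast
  qed
  then show ?thesis
    using minimal_map_iff_int[OF ndvd] power_orbit_cover[OF assms(1-3) cop] unfolding S_def by blast
qed

end
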